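(* Let $0<\eta<1/2$ and let $p,q\ge 3$ be integers such that $$q \le 0.01\,\eta\cdot\left(\frac{\log p}{\log\log p}\right)^{1/3}.$$ Then there exists a family $\mathcal{F}$ of lines in $\mathbb{R}^2$ which satisfies the $(p,q)$ property and cannot be pierced by fewer than $p^{1+\frac{1-\eta}{4q-7}}$ points. Consequently, $\mathsf{HD}_d(p,q)\ge p^{1+\frac{1-\eta}{4q-7}}$ for all $d\ge 2$ with $q\ge d+1$.
   Context: Logarithms are natural. A family of sets satisfies the $(p,q)$ property if among any $p$ sets of the family, some $q$ have a non-empty intersection. A family is pierced by a set $X$ of points if every member of the family contains at least one point of $X$. For integers $p\ge q\ge d+1$, the Hadwiger-Debrunner number $\mathsf{HD}_d(p,q)$ is the minimum number $c$ such that every finite family of convex sets in $\mathbb{R}^d$ that satisfies the $(p,q)$ property can be pierced by at most $c$ points (such a finite $c$ exists by the Alon-Kleitman theorem). *)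

theory Defs
  imports "HOL-Analysis.Analysis"
begin

definition pq_property :: "nat \<Rightarrow> nat \<Rightarrow> 'a set set \<Rightarrow> bool" where
  "pq_property p q F \<longleftrightarrow>
     (\<forall>G\<subseteq>F. finite G \<and> card G = p \<longrightarrow> (\<exists>H\<subseteq>G. card H = q \<and> \<Inter>H \<noteq> {}))"

definition pierces :: "'a set \<Rightarrow> 'a set set \<Rightarrow> bool" where
  "pierces X F \<longleftrightarrow> (\<forall>S\<in>F. S \<inter> X \<noteq> {})"

definition is_line :: "'a::euclidean_space set \<Rightarrow> bool" where
  "is_line L \<longleftrightarrow> affine L \<and> aff_dim L = 1"

text \<open>
  The dimension \<open>d\<close> is \<open>CARD('d)\<close>. Convex sets are required to be nonempty, since a family
  containing the empty set cannot be pierced at all. The infimum is taken in \<^typ>\<open>enat\<close>, so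
  that the value would be \<open>\<infinity>\<close> if no admissible \<open>c\<close> existed; by the Alon-Kleitman theorem this
  does not happen when \<open>p \<ge> q \<ge> d + 1\<close>, and the infimum is then the minimum.
\<close>

definition HD :: "'d::finite itself \<Rightarrow> nat \<Rightarrow> nat \<Rightarrow> enat" where
  "HD _ p q = Inf (enat ` {c.
     \<forall>F :: (real ^ 'd) set set.
       finite F \<and> (\<forall>S\<in>F. convex S \<and> S \<noteq> {}) \<and> pq_property p q F \<longrightarrow>
       (\<exists>X. finite X \<and> card X \<le> c \<and> pierces X F)})"

end

theory Submission
  imports Defs
begin

text \<open>
  The line \<open>Y = t X + y\<close> is encoded by the integer point \<open>(t, y)\<close> of a box of size \<open>r \<times> r D\<close> with
  \<open>D = R ^ (q - 1)\<close>. The points \<open>(t, w + t v)\<close>, for fixed slope \<open>v < D\<close> and intercept \<open>w\<close>, encode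
  lines that all pass through \<open>(-v, w)\<close>. Every point of the box is on \<open>D\<close> such grid lines, each of
  at most \<open>r\<close> points, and two points are on at most one. If \<open>R\<close> is a little larger than \<open>r\<^sup>2\<close>, a
  container argument shows that the sets with fewer than \<open>q\<close> points on every grid line are all
  covered by few containers, each of relative size \<open>4 ^ q / r\<close>.

  Now choose about \<open>r D\<close> points of the box independently at random. By a union bound over the
  containers no \<open>p\<close> of them, \<open>p\<close> of order \<open>D\<close>, avoid having \<open>q\<close> on a grid line. By a union bound over
  the crossing points of the lines, at most \<open>b = O(q)\<close> of the chosen lines pass through any
  point of the plane, so piercing them takes about \<open>r D / b\<close> points. With all parameters powers of
  one integer \<open>\<rho>\<close> this gives the exponent \<open>1 + 9 / (22 (q - 1))\<close> up to lower order terms, which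
  is larger than \<open>1 + 1 / (4 q - 7)\<close> and leaves room for all losses.
\<close>

section \<open>Containers for linear systems\<close>

text \<open>The containers themselves need not avoid anything; only their number and size matter.
  The size bound is real because each phase multiplies it by a real factor below 1.\<close>

definition covered :: "'a set \<Rightarrow> 'a set set \<Rightarrow> nat \<Rightarrow> real \<Rightarrow> bool" where
  "covered U \<I> K m \<longleftrightarrow> (\<exists>\<C>. finite \<C> \<and> card \<C> \<le> K \<and>
     (\<forall>C\<in>\<C>. C \<subseteq> U \<and> real (card C) \<le> m) \<and> (\<forall>I\<in>\<I>. \<exists>C\<in>\<C>. I \<subseteq> C))"

lemma covered_single:
  assumes "W \<subseteq> U" "real (card W) \<le> m" "1 \<le> K" "\<And>I. I \<in> \<I> \<Longrightarrow> I \<subseteq> W"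
  shows "covered U \<I> K m"
  unfolding covered_def using assms by (intro exI[of _ "{W}"]) auto

lemma covered_mono:
  assumes "covered U \<I> K m" "\<J> \<subseteq> \<I>" "K \<le> K'" "m \<le> m'" "U \<subseteq> U'"
  shows "covered U' \<J> K' m'"
proof -
  obtain \<C> where "finite \<C>" "card \<C> \<le> K" "\<forall>C\<in>\<C>. C \<subseteq> U \<and> real (card C) \<le> m"
    "\<forall>I\<in>\<I>. \<exists>C\<in>\<C>. I \<subseteq> C"
    using assms(1) unfolding covered_def by blast
  then show ?thesis
    unfolding covered_def using assms(2-) by (intro exI[of _ \<C>]) force
qed

lemma covered_Un:
  assumes "covered U \<I> K m" "covered U \<J> K' m"
  shows "covered U (\<I> \<union> \<J>) (K + K') m"
proof -
  obtain \<C> where C: "finite \<C>" "card \<C> \<le> K" "\<forall>C\<in>\<C>. C \<subseteq> U \<and> real (card C) \<le> m"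
    "\<forall>I\<in>\<I>. \<exists>C\<in>\<C>. I \<subseteq> C"
    using assms(1) unfolding covered_def by blast
  obtain \<D> where D: "finite \<D>" "card \<D> \<le> K'" "\<forall>C\<in>\<D>. C \<subseteq> U \<and> real (card C) \<le> m"
    "\<forall>I\<in>\<J>. \<exists>C\<in>\<D>. I \<subseteq> C"
    using assms(2) unfolding covered_def by blast
  show ?thesis
    unfolding covered_def
  proof (intro exI[of _ "\<C> \<union> \<D>"] conjI ballI)
    show "finite (\<C> \<union> \<D>)" using C(1) D(1) by (rule finite_UnI)
    show "card (\<C> \<union> \<D>) \<le> K + K'"
      using card_Un_le[of \<C> \<D>] C(2) D(2) by linarith
  next
    fix E assume "E \<in> \<C> \<union> \<D>"
    then show "E \<subseteq> U" "real (card E) \<le> m" using C(3) D(3) by (auto dest: bspec)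
  next
    fix I assume "I \<in> \<I> \<union> \<J>"
    then show "\<exists>E\<in>\<C> \<union> \<D>. I \<subseteq> E"
      using C(4)[THEN bspec, of I] D(4)[THEN bspec, of I] bexI[of _ _ "\<C> \<union> \<D>"] by (metis UnE UnI1 UnI2)
  qed
qed

text \<open>Refining every container by a cover of its own multiplies the counts. The second cover
  is only asked to handle the members of \<open>\<I>\<close> inside \<open>C\<close>, so the phases
  of the container argument can be chained.\<close>

lemma covered_trans:
  assumes "covered U \<I> K m"
    and "\<And>C. C \<subseteq> U \<Longrightarrow> real (card C) \<le> m \<Longrightarrow> covered C {I \<in> \<I>. I \<subseteq> C} K' m'"
  shows "covered U \<I> (K * K') m'"
proof -
  obtain \<C> where C: "finite \<C>" "card \<C> \<le> K" "\<forall>C\<in>\<C>. C \<subseteq> U \<and> real (card C) \<le> m"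
    "\<forall>I\<in>\<I>. \<exists>C\<in>\<C>. I \<subseteq> C"
    using assms(1) unfolding covered_def by blast
  have "\<forall>C\<in>\<C>. \<exists>\<D>. finite \<D> \<and> card \<D> \<le> K' \<and> (\<forall>E\<in>\<D>. E \<subseteq> C \<and> real (card E) \<le> m') \<and>
      (\<forall>I\<in>{I \<in> \<I>. I \<subseteq> C}. \<exists>E\<in>\<D>. I \<subseteq> E)"
  proof
    fix C assume "C \<in> \<C>"
    then have "covered C {I \<in> \<I>. I \<subseteq> C} K' m'" using C(3) assms(2) by simp
    then show "\<exists>\<D>. finite \<D> \<and> card \<D> \<le> K' \<and> (\<forall>E\<in>\<D>. E \<subseteq> C \<and> real (card E) \<le> m') \<and>
      (\<forall>I\<in>{I \<in> \<I>. I \<subseteq> C}. \<exists>E\<in>\<D>. I \<subseteq> E)"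
      unfolding covered_def .
  qed
  then obtain \<D> where "\<forall>C\<in>\<C>. finite (\<D> C) \<and> card (\<D> C) \<le> K' \<and>
      (\<forall>E\<in>\<D> C. E \<subseteq> C \<and> real (card E) \<le> m') \<and> (\<forall>I\<in>{I \<in> \<I>. I \<subseteq> C}. \<exists>E\<in>\<D> C. I \<subseteq> E)"
    by (rule bchoice[THEN exE])
  then have D: "finite (\<D> C)" "card (\<D> C) \<le> K'" "\<And>E. E \<in> \<D> C \<Longrightarrow> E \<subseteq> C \<and> real (card E) \<le> m'"
      "\<And>I. I \<in> \<I> \<Longrightarrow> I \<subseteq> C \<Longrightarrow> \<exists>E\<in>\<D> C. I \<subseteq> E" if "C \<in> \<C>" for C
    using that by simp_all
  have "card (\<Union>C\<in>\<C>. \<D> C) \<le> (\<Sum>C\<in>\<C>. card (\<D> C))"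
    by (rule card_UN_le[OF C(1)])
  also have "\<dots> \<le> (\<Sum>C\<in>\<C>. K')"
    using D(2) by (intro sum_mono)
  also have "\<dots> \<le> K * K'"
    using C(2) by simp
  finally have card: "card (\<Union>C\<in>\<C>. \<D> C) \<le> K * K'" .
  show ?thesis
    unfolding covered_def
  proof (intro exI[of _ "\<Union>C\<in>\<C>. \<D> C"] conjI ballI)
    show "finite (\<Union>C\<in>\<C>. \<D> C)" using C(1) D(1) by (rule finite_UN_I)
    show "card (\<Union>C\<in>\<C>. \<D> C) \<le> K * K'" by (rule card)
  next
    fix E assume "E \<in> (\<Union>C\<in>\<C>. \<D> C)"
    then obtain C' where "C' \<in> \<C>" "E \<in> \<D> C'" by (rule UN_E)
    with D(3)[OF this] C(3) show "E \<subseteq> U" "real (card E) \<le> m'" by auto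
  next
    fix I assume I: "I \<in> \<I>"
    have "\<exists>C\<in>\<C>. I \<subseteq> C" using C(4) I by (rule bspec)
    then obtain C' where C': "C' \<in> \<C>" "I \<subseteq> C'" by (rule bexE)
    from D(4)[OF C'(1) I C'(2)] obtain E where "E \<in> \<D> C'" "I \<subseteq> E" by (rule bexE)
    with C'(1) show "\<exists>E\<in>(\<Union>C\<in>\<C>. \<D> C). I \<subseteq> E" by (intro bexI[of _ E] UN_I)
  qed
qed

section \<open>One phase of the container argument, then its iteration\<close>

lemma sum_card_Int_eq_sum_degree:
  assumes "finite J" "finite A"
  shows "(\<Sum>l\<in>J. card (B l \<inter> A)) = (\<Sum>x\<in>A. card {l \<in> J. x \<in> B l})"
proof -
  have "(\<Sum>l\<in>J. card (B l \<inter> A)) = (\<Sum>l\<in>J. \<Sum>x\<in>A. if x \<in> B l then 1 else 0)"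
    using assms by (intro sum.cong refl) (simp add: sum.If_cases Int_commute Collect_conj_eq[symmetric] Int_def)
  also have "\<dots> = (\<Sum>x\<in>A. \<Sum>l\<in>J. if x \<in> B l then 1 else 0)"
    by (rule sum.swap)
  also have "\<dots> = (\<Sum>x\<in>A. card {l \<in> J. x \<in> B l})"
    using assms by (intro sum.cong refl) (simp add: sum.If_cases Int_def)
  finally show ?thesis .
qed

text \<open>The recursion for the leaves of a decision tree with \<open>w + 1\<close> undecided
  points and \<open>Suc t\<close> positive answers allowed: a positive answer uses up one of these,
  a negative one removes a point.\<close>

lemma power_decision_tree: "(w + 1) ^ t + w ^ Suc t \<le> (w + 1 :: nat) ^ Suc t"
proof -
  have "w * w ^ t \<le> w * (w + 1) ^ t" by (intro mult_left_mono power_mono) auto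
  then show ?thesis by (simp add: algebra_simps)
qed

text \<open>
  The blocks \<open>B l\<close> are parts of lines that are known to contain at most \<open>k\<close> points of \<open>I\<close>. For \<open>k = 0\<close>
  their union can be discarded. For larger \<open>k\<close> one asks repeatedly whether a point \<open>x\<close> on many large
  blocks belongs to \<open>I\<close>: if so, removing \<open>x\<close> from these blocks leaves blocks with at most \<open>k - 1\<close>
  points of \<open>I\<close>; if not, \<open>x\<close> is discarded. After at most \<open>s\<close> positive answers the new blocks are
  dense enough for the induction hypothesis, unless a proportion \<open>c\<close> of \<open>U\<close> was discarded before.
\<close>

lemma containers_from_blocks:
  fixes line :: "'l \<Rightarrow> 'v set" and U :: "'v set" and R s r k :: nat and c :: real
  assumes linear: "\<And>l l' x y. \<lbrakk>x \<in> line l; y \<in> line l; x \<in> line l'; y \<in> line l'; x \<noteq> y\<rbrakk> \<Longrightarrow> l = l'"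
    and card_line: "\<And>l. card (line l) \<le> r" and fin_line: "\<And>l. finite (line l)"
    and U: "finite U" "card U \<le> 2 * s * R"
    and c: "0 < c" "4 * real s * real r \<le> c * card U"
  shows "\<lbrakk>finite J; \<And>l. l \<in> J \<Longrightarrow> B l \<subseteq> line l \<inter> U; \<And>l. l \<in> J \<Longrightarrow> 4 ^ k \<le> card (B l);
      \<And>x. x \<in> U \<Longrightarrow> card {l \<in> J. x \<in> B l} \<le> R ^ k;
      8 ^ k * c * card U * R ^ k \<le> real (\<Sum>l\<in>J. card (B l))\<rbrakk>
    \<Longrightarrow> covered U {I. I \<subseteq> U \<and> (\<forall>l\<in>J. card (I \<inter> B l) \<le> k)} ((card U + 1) ^ (k * s))
         ((1 - c) * card U)"
proof (induction k arbitrary: J B)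
  case 0
  \<comment> \<open>For \<open>k = 0\<close> each point is in at most one block, so the union of the
    blocks is as large as the number of incidences, at least \<open>c * card U\<close>, and the sets
    to be covered avoid it.\<close>
  let ?A = "\<Union>l\<in>J. B l"
  have AU: "?A \<subseteq> U" using 0(2) by blast
  have "(\<Sum>l\<in>J. card (B l)) = (\<Sum>l\<in>J. card (B l \<inter> U))"
    using 0(2) by (intro sum.cong refl arg_cong[where f = card]) auto
  also have "\<dots> = (\<Sum>x\<in>U. card {l \<in> J. x \<in> B l})"
    by (rule sum_card_Int_eq_sum_degree[OF 0(1) U(1)])
  also have "\<dots> = (\<Sum>x\<in>?A. card {l \<in> J. x \<in> B l})"
    using AU U(1) by (intro sum.mono_neutral_right) (auto simp: card_eq_0_iff)
  also have "\<dots> \<le> (\<Sum>x\<in>?A. 1)"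
    using 0(4) AU by (intro sum_mono) auto
  finally have "(\<Sum>l\<in>J. card (B l)) \<le> card ?A" by simp
  then have "real (\<Sum>l\<in>J. card (B l)) \<le> real (card ?A)"
    by (rule of_nat_mono)
  with 0(5) have "c * card U \<le> real (card ?A)"
    by simp
  moreover have "card (U - ?A) = card U - card ?A" "card ?A \<le> card U"
    using AU U(1) by (auto simp: card_Diff_subset finite_subset card_mono)
  ultimately have "real (card (U - ?A)) \<le> (1 - c) * card U"
    by (simp add: algebra_simps of_nat_diff)
  then show ?case
  proof (rule covered_single[rotated])
    fix I assume I: "I \<in> {I. I \<subseteq> U \<and> (\<forall>l\<in>J. card (I \<inter> B l) \<le> 0)}"
    have "I \<inter> B l = {}" if "l \<in> J" for l
      using I that finite_subset[OF _ U(1)] by (auto simp: card_eq_0_iff)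
    then show "I \<subseteq> U - ?A" using I by blast
  qed auto
next
  case (Suc k)
  let ?u = "card U"
  let ?K = "(?u + 1) ^ (k * s)"
  \<comment> \<open>The incidence hypothesis provides at least \<open>4 * d * card U\<close>
    incidences. Every positive answer will gain \<open>d\<close> incidences of new blocks, and
    \<open>s * d\<close> suffices for the induction hypothesis because
    \<open>card U \<le> 2 * s * R\<close>.\<close>
  define d where "d = 2 * 8 ^ k * c * real R ^ Suc k"
  have BU: "B l \<subseteq> U" "finite (B l)" if "l \<in> J" for l
    using Suc.prems(2)[OF that] U(1) finite_subset by blast+

  \<comment> \<open>\<open>W\<close> is the set of points not yet discarded, \<open>t\<close> the number of positive answers still allowed,
    and \<open>B' l\<close> for \<open>l \<in> J'\<close> are the new blocks.\<close>
  have step: "\<lbrakk>t + card W = n; W \<subseteq> U; t \<le> s; J' \<subseteq> J; \<And>l. l \<in> J' \<Longrightarrow> B' l \<subseteq> B l;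
      \<And>l. l \<in> J' \<Longrightarrow> 4 ^ k \<le> card (B' l); \<And>x. x \<in> U \<Longrightarrow> card {l \<in> J'. x \<in> B' l} \<le> R ^ k;
      card J' \<le> (s - t) * R ^ Suc k; real (s - t) * d \<le> real (\<Sum>l\<in>J'. card (B' l))\<rbrakk>
    \<Longrightarrow> covered U {I. I \<subseteq> W \<and> (\<forall>l\<in>J. card (I \<inter> B l) \<le> Suc k) \<and> (\<forall>l\<in>J'. card (I \<inter> B' l) \<le> k)}
          ((card W + 1) ^ t * ?K) ((1 - c) * ?u)" for n t W J' B'
  \<comment> \<open>Either answer lowers \<open>t + card W\<close>: a positive one lowers
    \<open>t\<close>, a negative one removes a point of \<open>W\<close>.\<close>
  proof (induction n arbitrary: t W J' B' rule: less_induct)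
    case (less n)
    have fin: "finite W" "finite J'"
      using less.prems(2,4) U(1) Suc.prems(1) finite_subset by auto
    have B'U: "B' l \<subseteq> U" "finite (B' l)" if "l \<in> J'" for l
    proof -
      have "l \<in> J" using that less.prems(4) by blast
      from BU[OF this] less.prems(5)[OF that] show "B' l \<subseteq> U" "finite (B' l)"
        by (auto intro: finite_subset)
    qed
    let ?inc = "real (\<Sum>l\<in>J'. card (B' l))"
    \<comment> \<open>The tree stops when \<open>W\<close> is itself a small enough container, or
      when the new blocks are dense enough for the outer induction hypothesis; otherwise another
      point is queried.\<close>
    consider "real (card W) \<le> (1 - c) * ?u" | "8 ^ k * c * ?u * R ^ k \<le> ?inc"
      | "real (card W) > (1 - c) * ?u" "?inc < 8 ^ k * c * ?u * R ^ k"
      by linarith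
    then show ?case
    proof cases
      case 1
      then show ?thesis using less.prems(2) by (intro covered_single[where W = W]) auto
    next
      case 2
      have "covered U {I. I \<subseteq> U \<and> (\<forall>l\<in>J'. card (I \<inter> B' l) \<le> k)} ?K ((1 - c) * ?u)"
      proof (rule Suc.IH[OF fin(2) _ less.prems(6,7) 2])
        fix l assume "l \<in> J'"
        then show "B' l \<subseteq> line l \<inter> U"
          using less.prems(4,5) Suc.prems(2) by blast
      qed auto
      then show ?thesis
        by (rule covered_mono) (use less.prems(2) in auto)
    next
      case 3
      have "0 \<le> ?inc" by (rule of_nat_0_le_iff)
      with 3(2) have "?u \<noteq> 0" by (intro notI) simp
      then have u0: "0 < real ?u" by simp
      have cu: "0 < c * ?u" using c(1) u0 by (rule mult_pos_pos)
      have R0: "0 < R" using u0 U(2) by (cases "R = 0") auto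
      \<comment> \<open>Once all \<open>s\<close> positive answers are used up, the accumulated
        incidences would put the situation in the second case.\<close>
      have t0: "0 < t"
      proof (rule ccontr)
        assume "\<not> 0 < t"
        then have "real s * d \<le> ?inc" using less.prems(9) by simp
        moreover have "real s * d = 8 ^ k * c * (2 * real s * real R) * real R ^ k"
          by (simp add: d_def)
        moreover have "real ?u \<le> 2 * real s * real R"
          using U(2) by (metis of_nat_le_iff of_nat_mult of_nat_numeral)
        then have "8 ^ k * c * ?u * R ^ k \<le> 8 ^ k * c * (2 * real s * real R) * real R ^ k"
          unfolding of_nat_power using c(1) by (intro mult_right_mono mult_left_mono) auto
        ultimately show False using 3(2) by linarith
      qed
      \<comment> \<open>Points of full degree get no further new blocks, which keeps the new degrees below \<open>R ^ k\<close>.\<close>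
      define Sat where "Sat = {x \<in> U. card {l \<in> J'. x \<in> B' l} = R ^ k}"
      define Y where "Y = W - Sat"
      have finY: "finite Y" and YU: "Y \<subseteq> U" and finSat: "finite Sat"
        using fin(1) less.prems(2) U(1) by (auto simp: Y_def Sat_def)
      have "card Sat * R ^ k = (\<Sum>x\<in>Sat. card {l \<in> J'. x \<in> B' l})"
        by (simp add: Sat_def)
      also have "\<dots> \<le> (\<Sum>x\<in>U. card {l \<in> J'. x \<in> B' l})"
        using U(1) by (intro sum_mono2) (auto simp: Sat_def)
      also have "\<dots> = (\<Sum>l\<in>J'. card (B' l \<inter> U))"
        by (rule sum_card_Int_eq_sum_degree[OF fin(2) U(1), symmetric])
      also have "\<dots> = (\<Sum>l\<in>J'. card (B' l))"
        using B'U by (intro sum.cong refl arg_cong[where f = card]) auto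
      finally have "real (card Sat) * real (R ^ k) \<le> ?inc"
        using of_nat_mono by fastforce
      with 3(2) have "real (card Sat) * real (R ^ k) < (8 ^ k * c * ?u) * real (R ^ k)"
        by linarith
      then have Sat: "real (card Sat) < 8 ^ k * c * ?u"
        using R0 by simp
      \<comment> \<open>The points of \<open>U\<close> outside \<open>Y\<close> are the discarded
        ones, fewer than \<open>c * card U\<close> since the first case fails, and the saturated
        ones, fewer than \<open>8 ^ k * c * card U\<close> since the second case fails.\<close>
      have "card (U - Y) \<le> card (U - W) + card Sat"
      proof -
        have "card (U - Y) \<le> card ((U - W) \<union> Sat)"
          using U(1) finSat by (intro card_mono) (auto simp: Y_def)
        then show ?thesis using card_Un_le[of "U - W" Sat] by linarith
      qed
      moreover have "card (U - W) = card U - card W" "card W \<le> card U"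
        using less.prems(2) fin(1) U(1) by (auto simp: card_Diff_subset card_mono)
      moreover have "1 * (c * ?u) \<le> 8 ^ k * (c * ?u)"
        using cu by (intro mult_right_mono) auto
      ultimately have lost: "real (card (U - Y)) \<le> 2 * (8 ^ k * c * ?u)"
        using 3(1) Sat by (simp add: algebra_simps of_nat_diff)
      \<comment> \<open>The strict inequality leaves room for removing the queried point and still
        having \<open>4 ^ k\<close> points.\<close>
      define Rich where "Rich = {l \<in> J - J'. 4 ^ k < card (B l \<inter> Y)}"
      have finRich: "finite Rich" using Suc.prems(1) by (simp add: Rich_def)
      \<comment> \<open>Averaging: of the at least \<open>4 * d * card U\<close> incidences, at most
        \<open>d * card U\<close> lie outside \<open>Y\<close>, at most
        \<open>d * card U / 8\<close> on blocks already used, and at most a quarter of the total on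
        poor blocks. The rich blocks keep at least \<open>15/8 * d * card U\<close> of them inside
        \<open>Y\<close>.\<close>
      have "\<exists>x\<in>Y. d \<le> real (card {l \<in> Rich. x \<in> B l})"
      proof -
        have "(\<Sum>l\<in>J. card (B l)) \<le> (\<Sum>l\<in>J. card (B l \<inter> (U - Y)) + (if l \<in> J' then r else 0) +
            (if l \<in> Rich then card (B l \<inter> Y) else 0) + 4 ^ k)"
        proof (rule sum_mono)
          fix l assume l: "l \<in> J"
          have "card (B l) \<le> r"
            using Suc.prems(2)[OF l] card_line[of l] card_mono[OF fin_line[of l], of "B l"] by auto
          moreover have "card (B l) = card (B l \<inter> (U - Y)) + card (B l \<inter> Y)"
          proof -
            have "card ((B l \<inter> (U - Y)) \<union> (B l \<inter> Y)) = card (B l \<inter> (U - Y)) + card (B l \<inter> Y)"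
              using BU[OF l] by (intro card_Un_disjoint) auto
            moreover have "(B l \<inter> (U - Y)) \<union> (B l \<inter> Y) = B l" using BU(1)[OF l] YU by auto
            ultimately show ?thesis by simp
          qed
          ultimately show "card (B l) \<le> card (B l \<inter> (U - Y)) + (if l \<in> J' then r else 0) +
            (if l \<in> Rich then card (B l \<inter> Y) else 0) + 4 ^ k"
            using l by (auto simp: Rich_def)
        qed
        also have "\<dots> = (\<Sum>l\<in>J. card (B l \<inter> (U - Y))) + card J' * r + (\<Sum>l\<in>Rich. card (B l \<inter> Y)) + card J * 4 ^ k"
        proof -
          have "J \<inter> J' = J'" "J \<inter> Rich = Rich" using less.prems(4) by (auto simp: Rich_def)
          then show ?thesis
            using Suc.prems(1) by (simp add: sum.distrib sum.If_cases)
        qed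
        finally have 1: "(\<Sum>l\<in>J. card (B l)) \<le> (\<Sum>l\<in>J. card (B l \<inter> (U - Y))) + card J' * r
            + (\<Sum>l\<in>Rich. card (B l \<inter> Y)) + card J * 4 ^ k" .
        have "(\<Sum>l\<in>J. card (B l \<inter> (U - Y))) = (\<Sum>x\<in>U - Y. card {l \<in> J. x \<in> B l})"
          using U(1) by (intro sum_card_Int_eq_sum_degree Suc.prems(1)) auto
        also have "\<dots> \<le> (\<Sum>x\<in>U - Y. R ^ Suc k)"
          by (intro sum_mono Suc.prems(4)) auto
        finally have "(\<Sum>l\<in>J. card (B l \<inter> (U - Y))) \<le> card (U - Y) * R ^ Suc k" by simp
        then have "real (\<Sum>l\<in>J. card (B l \<inter> (U - Y))) \<le> real (card (U - Y) * R ^ Suc k)"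
          by (rule of_nat_mono)
        also have "\<dots> \<le> 2 * (8 ^ k * c * ?u) * real (R ^ Suc k)"
          unfolding of_nat_mult by (intro mult_right_mono lost) auto
        finally have 2: "real (\<Sum>l\<in>J. card (B l \<inter> (U - Y))) \<le> d * ?u"
          by (simp add: d_def mult_ac)
        have "card J' * r \<le> s * R ^ Suc k * r"
          using less.prems(8) by (meson diff_le_self le_trans mult_le_mono1)
        then have "real (card J' * r) \<le> real (s * R ^ Suc k * r)"
          by (rule of_nat_mono)
        also have "\<dots> = (real s * real r) * real R ^ Suc k" by simp
        also have "\<dots> \<le> (8 ^ k * (c * ?u) / 4) * real R ^ Suc k"
          using c(2) \<open>1 * (c * ?u) \<le> 8 ^ k * (c * ?u)\<close> by (intro mult_right_mono) auto
        finally have 3: "real (card J' * r) \<le> d * ?u / 8" by (simp add: d_def mult_ac)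
        have "card J * 4 ^ Suc k = (\<Sum>l\<in>J. 4 ^ Suc k)" by simp
        also have "\<dots> \<le> (\<Sum>l\<in>J. card (B l))" by (intro sum_mono Suc.prems(3))
        finally have 4: "real (card J * 4 ^ k) \<le> real (\<Sum>l\<in>J. card (B l)) / 4"
          using of_nat_mono[of "card J * 4 ^ Suc k" "\<Sum>l\<in>J. card (B l)", where 'a = real] by simp
        have 5: "4 * (d * ?u) \<le> real (\<Sum>l\<in>J. card (B l))"
          using Suc.prems(5) by (simp add: d_def mult_ac)
        have "real (\<Sum>l\<in>J. card (B l)) \<le> real (\<Sum>l\<in>J. card (B l \<inter> (U - Y))) + real (card J' * r)
            + real (\<Sum>l\<in>Rich. card (B l \<inter> Y)) + real (card J * 4 ^ k)"
          using of_nat_mono[OF 1, where 'a = real] by (simp only: of_nat_add)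
        with 2 3 4 5 have "15/8 * (d * ?u) \<le> real (\<Sum>l\<in>Rich. card (B l \<inter> Y))"
          by linarith
        moreover have "0 < d * ?u"
          using R0 cu u0 c(1) by (simp add: d_def)
        ultimately have big: "d * ?u < real (\<Sum>l\<in>Rich. card (B l \<inter> Y))" by linarith
        show ?thesis
        proof (rule ccontr)
          assume neg: "\<not> ?thesis"
          have "real (\<Sum>l\<in>Rich. card (B l \<inter> Y)) = (\<Sum>x\<in>Y. real (card {l \<in> Rich. x \<in> B l}))"
            by (simp add: sum_card_Int_eq_sum_degree[OF finRich finY] flip: of_nat_sum)
          also have "\<dots> \<le> (\<Sum>x\<in>Y. d)" using neg by (intro sum_mono) force
          also have "\<dots> \<le> ?u * d"
            using card_mono[OF U(1) YU] \<open>0 < d * ?u\<close> u0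
            by (simp add: mult_right_mono zero_less_mult_iff)
          finally show False using big by (simp add: mult_ac)
        qed
      qed
      then obtain x where x: "x \<in> Y" and dx: "d \<le> real (card {l \<in> Rich. x \<in> B l})" by blast
      define L where "L = {l \<in> Rich. x \<in> B l}"
      \<comment> \<open>Removing \<open>x\<close> turns the bound \<open>Suc k\<close> into
        \<open>k\<close> for sets containing \<open>x\<close>; restricting to \<open>Y\<close> keeps
        saturated points from gaining a block.\<close>
      define B1 where "B1 = (\<lambda>l. if l \<in> L then B l \<inter> Y - {x} else B' l)"
      have LJ: "L \<subseteq> J - J'" "finite L"
        using finRich by (auto simp: L_def) (auto simp: Rich_def)
      have xW: "x \<in> W" "x \<in> U" using x YU by (auto simp: Y_def)
      let ?I1 = "{I. I \<subseteq> W \<and> (\<forall>l\<in>J. card (I \<inter> B l) \<le> Suc k) \<and> (\<forall>l\<in>J' \<union> L. card (I \<inter> B1 l) \<le> k)}"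
      let ?I2 = "{I. I \<subseteq> W - {x} \<and> (\<forall>l\<in>J. card (I \<inter> B l) \<le> Suc k) \<and> (\<forall>l\<in>J'. card (I \<inter> B' l) \<le> k)}"
      have B1L: "B1 l = B l \<inter> Y - {x}" if "l \<in> L" for l using that by (simp add: B1_def)
      have B1J': "B1 l = B' l" if "l \<in> J'" for l using that LJ(1) by (auto simp: B1_def)
      have cardB1L: "4 ^ k \<le> card (B1 l)" if "l \<in> L" for l
      proof -
        have "x \<in> B l \<inter> Y" "4 ^ k < card (B l \<inter> Y)" "finite (B l \<inter> Y)"
          using that x finY by (auto simp: L_def Rich_def)
        then show ?thesis unfolding B1L[OF that] by (simp add: card_Diff_singleton)
      qed
      have cov1: "covered U ?I1 ((card W + 1) ^ (t - 1) * ?K) ((1 - c) * ?u)"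
      proof (rule less.IH[OF _ refl less.prems(2)])
        show "t - 1 + card W < n" using t0 less.prems(1) by simp
        show "t - 1 \<le> s" using less.prems(3) by simp
        show "J' \<union> L \<subseteq> J" using LJ less.prems(4) by blast
        show "B1 l \<subseteq> B l" if "l \<in> J' \<union> L" for l
          using that B1L B1J' less.prems(5) by blast
        show "4 ^ k \<le> card (B1 l)" if "l \<in> J' \<union> L" for l
          using that cardB1L B1J' less.prems(6) by (metis UnE)
        have s: "s - (t - 1) = Suc (s - t)" using t0 less.prems(3) by simp
        have "card L \<le> card {l \<in> J. x \<in> B l}"
          using Suc.prems(1) by (intro card_mono) (auto simp: L_def Rich_def)
        also have "\<dots> \<le> R ^ Suc k" by (rule Suc.prems(4)[OF xW(2)])
        finally have "card L \<le> R ^ Suc k" .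
        then have "card (J' \<union> L) \<le> (s - t) * R ^ Suc k + R ^ Suc k"
          using less.prems(8) card_Un_le[of J' L] by linarith
        then show "card (J' \<union> L) \<le> (s - (t - 1)) * R ^ Suc k"
          unfolding s mult_Suc by linarith
        have "real (card L) \<le> real (\<Sum>l\<in>L. card (B1 l))"
        proof -
          have "card L = (\<Sum>l\<in>L. 1)" by simp
          also have "\<dots> \<le> (\<Sum>l\<in>L. card (B1 l))"
            using cardB1L by (intro sum_mono) (meson le_trans one_le_power numeral_le_iff one_le_numeral)
          finally show ?thesis by (rule of_nat_mono)
        qed
        moreover have "(\<Sum>l\<in>J' \<union> L. card (B1 l)) = (\<Sum>l\<in>J'. card (B' l)) + (\<Sum>l\<in>L. card (B1 l))"
          using LJ fin(2) B1J' by (subst sum.union_disjoint) auto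
        ultimately have "real (s - t) * d + d \<le> real (\<Sum>l\<in>J' \<union> L. card (B1 l))"
          using less.prems(9) dx by (simp only: L_def[symmetric] of_nat_add)
        then show "real (s - (t - 1)) * d \<le> real (\<Sum>l\<in>J' \<union> L. card (B1 l))"
          unfolding s of_nat_Suc by (simp add: algebra_simps)
        \<comment> \<open>By linearity only one line passes through both \<open>x\<close> and
          \<open>y\<close>, so the degree of \<open>y\<close> grows by at most one, and only if it
          was below \<open>R ^ k\<close>.\<close>
        show "card {l \<in> J' \<union> L. y \<in> B1 l} \<le> R ^ k" if y: "y \<in> U" for y
        proof -
          have eq: "{l \<in> J' \<union> L. y \<in> B1 l} = {l \<in> J'. y \<in> B' l} \<union> {l \<in> L. y \<in> B l \<inter> Y - {x}}"
            using B1L B1J' by auto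
          show ?thesis
          proof (cases "y \<in> Y \<and> y \<noteq> x")
            case False
            then have "{l \<in> J' \<union> L. y \<in> B1 l} = {l \<in> J'. y \<in> B' l}" unfolding eq by auto
            then show ?thesis using less.prems(7)[OF y] by simp
          next
            case True
            then have "card {l \<in> J'. y \<in> B' l} \<noteq> R ^ k" using y by (auto simp: Y_def Sat_def)
            with less.prems(7)[OF y] have "card {l \<in> J'. y \<in> B' l} < R ^ k" by simp
            moreover have "card {l \<in> L. y \<in> B l \<inter> Y - {x}} \<le> 1"
            proof -
              have on: "x \<in> line l \<and> y \<in> line l" if "l \<in> L" "y \<in> B l" for l
              proof -
                have "l \<in> J" "x \<in> B l" using that(1) by (auto simp: L_def Rich_def)
                with Suc.prems(2) that(2) show ?thesis by blast
              qed
              have "l = l'" if "l \<in> L" "l' \<in> L" "y \<in> B l" "y \<in> B l'" for l l'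
                using on[OF that(1,3)] on[OF that(2,4)] True linear[of x l y l'] by metis
              then show ?thesis using LJ(2) by (auto simp: card_le_Suc0_iff_eq)
            qed
            ultimately show ?thesis unfolding eq
              using card_Un_le[of "{l \<in> J'. y \<in> B' l}" "{l \<in> L. y \<in> B l \<inter> Y - {x}}"] by linarith
          qed
        qed
      qed
      have W': "card (W - {x}) = card W - 1" "0 < card W"
        using xW(1) fin(1) by (auto simp: card_gt_0_iff)
      have cov2: "covered U ?I2 ((card (W - {x}) + 1) ^ t * ?K) ((1 - c) * ?u)"
        using less.prems W' by (intro less.IH[OF _ refl]) (auto simp del: card_Diff_insert)
      have "{I. I \<subseteq> W \<and> (\<forall>l\<in>J. card (I \<inter> B l) \<le> Suc k) \<and> (\<forall>l\<in>J'. card (I \<inter> B' l) \<le> k)} \<subseteq> ?I1 \<union> ?I2"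
      proof
        fix I assume I: "I \<in> {I. I \<subseteq> W \<and> (\<forall>l\<in>J. card (I \<inter> B l) \<le> Suc k) \<and> (\<forall>l\<in>J'. card (I \<inter> B' l) \<le> k)}"
        show "I \<in> ?I1 \<union> ?I2"
        proof (cases "x \<in> I")
          case False
          then show ?thesis using I by auto
        next
          case True
          have "card (I \<inter> B1 l) \<le> k" if l: "l \<in> L" for l
          proof -
            have "I \<inter> B1 l \<subseteq> I \<inter> B l - {x}" unfolding B1L[OF l] by blast
            moreover have f: "finite (I \<inter> B l)" using BU(2) LJ(1) l by blast
            ultimately have "card (I \<inter> B1 l) \<le> card (I \<inter> B l - {x})" by (intro card_mono) auto
            moreover have "x \<in> I \<inter> B l" using True l by (auto simp: L_def)
            moreover have "card (I \<inter> B l) \<le> Suc k" using I l LJ(1) by blast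
            ultimately show ?thesis using f by (simp add: card_Diff_singleton)
          qed
          then show ?thesis using I B1J' by auto
        qed
      qed
      moreover have "(card W + 1) ^ (t - 1) * ?K + (card (W - {x}) + 1) ^ t * ?K \<le> (card W + 1) ^ t * ?K"
        using power_decision_tree[of "card W" "t - 1"] t0 W'
        by (simp flip: add_mult_distrib del: power_Suc)
      ultimately show ?thesis
        by (intro covered_mono[OF covered_Un[OF cov1 cov2]]) simp_all
    qed
  qed
  \<comment> \<open>The root of the tree: nothing is discarded, all \<open>s\<close> positive
    answers are available and there are no new blocks.\<close>
  have "covered U {I. I \<subseteq> U \<and> (\<forall>l\<in>J. card (I \<inter> B l) \<le> Suc k) \<and> (\<forall>l\<in>{}. card (I \<inter> B l) \<le> k)}
          ((card U + 1) ^ s * ?K) ((1 - c) * ?u)"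
    by (rule step[OF refl]) auto
  then show ?case by (simp add: power_add)
qed

text \<open>The blocks are the sets \<open>line l \<inter> U\<close> with at least
  \<open>4 ^ k\<close> points, and \<open>c = 1 / (2 * 8 ^ k)\<close>. By the last bound on
  \<open>card \<Lambda>\<close> the poorer lines carry at most half of the incidences, and the
  remaining half is exactly what this \<open>c\<close> demands.\<close>

lemma container_phase:
  fixes line :: "'l \<Rightarrow> 'v set" and U :: "'v set" and R s r k :: nat
  assumes linear: "\<And>l l' x y. \<lbrakk>x \<in> line l; y \<in> line l; x \<in> line l'; y \<in> line l'; x \<noteq> y\<rbrakk> \<Longrightarrow> l = l'"
    and card_line: "\<And>l. card (line l) \<le> r" and fin_line: "\<And>l. finite (line l)"
    and fin: "finite \<Lambda>" "finite U"
    and degree: "\<And>x. x \<in> U \<Longrightarrow> card {l \<in> \<Lambda>. x \<in> line l} = R ^ k"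
    and U: "card U \<le> 2 * s * R" "8 * 8 ^ k * s * r \<le> card U" "2 * 4 ^ k * card \<Lambda> \<le> card U * R ^ k"
  shows "covered U {I. I \<subseteq> U \<and> (\<forall>l\<in>\<Lambda>. card (I \<inter> line l) \<le> k)} ((card U + 1) ^ (k * s))
    ((1 - 1 / (2 * 8 ^ k)) * card U)"
proof -
  define J where "J = {l \<in> \<Lambda>. 4 ^ k \<le> card (line l \<inter> U)}"
  have finJ: "finite J" and J\<Lambda>: "J \<subseteq> \<Lambda>" using fin by (auto simp: J_def)
  have "card U * R ^ k = (\<Sum>x\<in>U. card {l \<in> \<Lambda>. x \<in> line l})"
    using degree by simp
  also have "\<dots> = (\<Sum>l\<in>\<Lambda>. card (line l \<inter> U))"
    by (rule sum_card_Int_eq_sum_degree[OF fin, symmetric])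
  also have "\<dots> \<le> (\<Sum>l\<in>\<Lambda>. (if l \<in> J then card (line l \<inter> U) else 0) + 4 ^ k)"
    by (intro sum_mono) (auto simp: J_def)
  also have "\<dots> = (\<Sum>l\<in>J. card (line l \<inter> U)) + card \<Lambda> * 4 ^ k"
  proof -
    have "\<Lambda> \<inter> J = J" using J\<Lambda> by auto
    then show ?thesis using fin by (simp add: sum.distrib sum.If_cases)
  qed
  finally have "card U * R ^ k \<le> 2 * (\<Sum>l\<in>J. card (line l \<inter> U))"
    using U(3) by (simp add: algebra_simps)
  then have "real (card U * R ^ k) \<le> real (2 * (\<Sum>l\<in>J. card (line l \<inter> U)))"
    by (rule of_nat_mono)
  then have inc: "8 ^ k * (1 / (2 * 8 ^ k)) * card U * R ^ k \<le> real (\<Sum>l\<in>J. card (line l \<inter> U))"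
    by simp
  have "real (8 * 8 ^ k * s * r) \<le> real (card U)"
    using U(2) by (rule of_nat_mono)
  then have c: "4 * real s * real r \<le> 1 / (2 * 8 ^ k) * card U"
    by (simp add: field_simps)
  have deg: "card {l \<in> J. x \<in> line l \<inter> U} \<le> R ^ k" if "x \<in> U" for x
  proof -
    have "card {l \<in> J. x \<in> line l \<inter> U} \<le> card {l \<in> \<Lambda>. x \<in> line l}"
      using fin J\<Lambda> by (intro card_mono) auto
    then show ?thesis using degree[OF that] by simp
  qed
  have "covered U {I. I \<subseteq> U \<and> (\<forall>l\<in>J. card (I \<inter> (line l \<inter> U)) \<le> k)} ((card U + 1) ^ (k * s))
    ((1 - 1 / (2 * 8 ^ k)) * card U)"
    by (rule containers_from_blocks[where line = line and r = r and R = R])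
      (use linear card_line fin_line fin U(1) c deg inc finJ in \<open>auto simp: J_def\<close>)
  moreover have "I \<inter> (line l \<inter> U) = I \<inter> line l" if "I \<subseteq> U" for I l
    using that by blast
  then have "{I. I \<subseteq> U \<and> (\<forall>l\<in>\<Lambda>. card (I \<inter> line l) \<le> k)}
      \<subseteq> {I. I \<subseteq> U \<and> (\<forall>l\<in>J. card (I \<inter> (line l \<inter> U)) \<le> k)}"
    using J\<Lambda> by auto
  ultimately show ?thesis by (rule covered_mono) auto
qed

text \<open>Iterates the phase \<open>n\<close> times, leaving alone containers that already have at
  most \<open>m\<close> points. The size conditions of a phase therefore only have to hold with
  \<open>m\<close> in place of the container size.\<close>

lemma containers:
  fixes line :: "'l \<Rightarrow> 'v set" and V :: "'v set" and R s r k m :: nat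
  assumes linear: "\<And>l l' x y. \<lbrakk>x \<in> line l; y \<in> line l; x \<in> line l'; y \<in> line l'; x \<noteq> y\<rbrakk> \<Longrightarrow> l = l'"
    and card_line: "\<And>l. card (line l) \<le> r" and fin_line: "\<And>l. finite (line l)"
    and fin: "finite \<Lambda>" "finite V"
    and degree: "\<And>x. x \<in> V \<Longrightarrow> card {l \<in> \<Lambda>. x \<in> line l} = R ^ k"
    and V: "card V \<le> 2 * s * R" "8 * 8 ^ k * s * r \<le> m" "2 * 4 ^ k * card \<Lambda> \<le> m * R ^ k"
  shows "covered V {I. I \<subseteq> V \<and> (\<forall>l\<in>\<Lambda>. card (I \<inter> line l) \<le> k)} ((card V + 1) ^ (k * s * n))
    (max m ((1 - 1 / (2 * 8 ^ k)) ^ n * card V))"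
proof (induction n)
  case 0
  show ?case by (rule covered_single[where W = V]) auto
next
  case (Suc n)
  let ?c = "1 - 1 / (2 * 8 ^ k) :: real"
  let ?\<I> = "{I. I \<subseteq> V \<and> (\<forall>l\<in>\<Lambda>. card (I \<inter> line l) \<le> k)}"
  have c: "0 \<le> ?c" "?c \<le> 1" proof -
    have "1 \<le> (8 :: real) ^ k" by (rule one_le_power) simp
    then have "1 \<le> 2 * (8 :: real) ^ k" by linarith
    then show "0 \<le> ?c" "?c \<le> 1" by (auto simp: divide_le_eq)
  qed
  have "covered V ?\<I> ((card V + 1) ^ (k * s * n) * (card V + 1) ^ (k * s)) (max m (?c ^ Suc n * card V))"
  proof (rule covered_trans[OF Suc.IH])
    fix C assume C: "C \<subseteq> V" "real (card C) \<le> max m (?c ^ n * card V)"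
    have finC: "finite C" and CV: "card C \<le> card V"
      using C(1) fin(2) by (auto simp: finite_subset card_mono)
    show "covered C {I \<in> ?\<I>. I \<subseteq> C} ((card V + 1) ^ (k * s)) (max m (?c ^ Suc n * card V))"
    proof (cases "card C \<le> m")
      case True
      then show ?thesis by (intro covered_single[where W = C]) auto
    next
      case False
      have "8 * 8 ^ k * s * r \<le> card C" "card C \<le> 2 * s * R" using False V(1,2) CV by linarith+
      moreover have "2 * 4 ^ k * card \<Lambda> \<le> card C * R ^ k"
        using V(3) False by (meson le_trans mult_le_mono1 nat_le_linear)
      moreover have "card {l \<in> \<Lambda>. x \<in> line l} = R ^ k" if "x \<in> C" for x
        using that C(1) degree by blast
      ultimately have "covered C {I. I \<subseteq> C \<and> (\<forall>l\<in>\<Lambda>. card (I \<inter> line l) \<le> k)} ((card C + 1) ^ (k * s)) (?c * card C)"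
        using linear card_line fin_line fin(1) finC by (intro container_phase[where r = r and R = R]) auto
      then show ?thesis
      proof (rule covered_mono)
        have "?c * card C \<le> ?c * (?c ^ n * card V)"
          using False C(2) c(1) by (intro mult_left_mono) auto
        then show "?c * card C \<le> max m (?c ^ Suc n * card V)" by simp
        show "(card C + 1) ^ (k * s) \<le> (card V + 1) ^ (k * s)"
          using CV by (intro power_mono) auto
      qed auto
    qed
  qed
  then show ?case by (simp add: power_add mult.commute)
qed

section \<open>Random choice of points\<close>

lemma card_functions_with_image:
  assumes "finite V" "C \<subseteq> V" "P \<subseteq> {..<N::nat}"
  shows "card {f \<in> {..<N} \<rightarrow>\<^sub>E V. f ` P \<subseteq> C} = card C ^ card P * card V ^ (N - card P)"
proof -
  have "{f \<in> {..<N} \<rightarrow>\<^sub>E V. f ` P \<subseteq> C} = PiE {..<N} (\<lambda>i. if i \<in> P then C else V)"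
    using assms(2,3) by (auto simp: PiE_def Pi_def split: if_splits)
  then have "card {f \<in> {..<N} \<rightarrow>\<^sub>E V. f ` P \<subseteq> C} = (\<Prod>i<N. card (if i \<in> P then C else V))"
    by (simp add: card_PiE)
  also have "\<dots> = (\<Prod>i<N. if i \<in> P then card C else card V)"
    by (intro prod.cong) auto
  also have "\<dots> = card C ^ card P * card V ^ card ({..<N} - P)"
    using assms(3) by (simp add: prod.If_cases Int_absorb1 Diff_eq Compl_eq)
  also have "card ({..<N} - P) = N - card P"
    using assms(3) by (simp add: card_Diff_subset finite_subset)
  finally show ?thesis .
qed

text \<open>A union bound over the sets in \<open>\<C>\<close> and the \<open>k\<close>-sets of
  positions. The functions stand for \<open>N\<close> independent uniform points with repetitions
  allowed, and dividing by \<open>card V ^ N\<close> turns counts into probabilities.\<close>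

lemma card_functions_hitting_le:
  assumes V: "finite V" "V \<noteq> {}" and \<C>: "finite \<C>" "\<And>C. C \<in> \<C> \<Longrightarrow> C \<subseteq> V" "\<And>C. C \<in> \<C> \<Longrightarrow> real (card C) \<le> m"
  shows "real (card {f \<in> {..<N::nat} \<rightarrow>\<^sub>E V. \<exists>C\<in>\<C>. \<exists>P\<subseteq>{..<N}. card P = k \<and> f ` P \<subseteq> C})
    \<le> card \<C> * real (N choose k) * (m / card V) ^ k * card V ^ N"
proof (cases "k \<le> N")
  case True
  let ?\<P> = "{P. P \<subseteq> {..<N} \<and> card P = k}"
  let ?F = "\<lambda>(C, P). {f \<in> {..<N} \<rightarrow>\<^sub>E V. f ` P \<subseteq> C}"
  have "real (card {f \<in> {..<N} \<rightarrow>\<^sub>E V. \<exists>C\<in>\<C>. \<exists>P\<subseteq>{..<N}. card P = k \<and> f ` P \<subseteq> C})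
      = real (card (\<Union>CP\<in>\<C> \<times> ?\<P>. ?F CP))"
    by (intro arg_cong[where f = "\<lambda>A. real (card A)"]) auto
  also have "\<dots> \<le> real (\<Sum>CP\<in>\<C> \<times> ?\<P>. card (?F CP))"
    using \<C>(1) by (intro of_nat_mono card_UN_le) auto
  also have "\<dots> = (\<Sum>CP\<in>\<C> \<times> ?\<P>. real (card (?F CP)))"
    by simp
  also have "\<dots> \<le> (\<Sum>CP\<in>\<C> \<times> ?\<P>. m ^ k * card V ^ (N - k))"
  proof (intro sum_mono)
    fix CP assume "CP \<in> \<C> \<times> ?\<P>"
    then obtain C P where CP: "CP = (C, P)" "C \<in> \<C>" "P \<subseteq> {..<N}" "card P = k" by auto
    show "real (card (?F CP)) \<le> m ^ k * card V ^ (N - k)"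
      using card_functions_with_image[OF V(1) \<C>(2)[OF CP(2)] CP(3)] \<C>(3)[OF CP(2)] CP(1,4)
      by (auto intro!: mult_right_mono power_mono)
  qed
  also have "\<dots> = card \<C> * real (N choose k) * (m ^ k * card V ^ (N - k))"
    by (simp add: card_cartesian_product n_subsets)
  also have "m ^ k * card V ^ (N - k) = (m / card V) ^ k * card V ^ N"
  proof -
    have "real (card V) ^ N = real (card V) ^ (N - k) * real (card V) ^ k"
      using True by (simp flip: power_add)
    moreover have "0 < real (card V)" using V by (simp add: card_gt_0_iff)
    ultimately show ?thesis by (simp add: power_divide field_simps)
  qed
  finally show ?thesis by (simp add: mult_ac)
next
  case False
  then have "\<not> (\<exists>P\<subseteq>{..<N}. card P = k \<and> f ` P \<subseteq> C)" for f :: "nat \<Rightarrow> 'a" and C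
    by (metis card_lessThan card_mono finite_lessThan)
  then have "{f \<in> {..<N} \<rightarrow>\<^sub>E V. \<exists>C\<in>\<C>. \<exists>P\<subseteq>{..<N}. card P = k \<and> f ` P \<subseteq> C} = {}" by blast
  moreover have "N choose k = 0" using False by (simp add: binomial_eq_0)
  ultimately show ?thesis by (simp only: card.empty)
qed

section \<open>Concurrent lines in the plane\<close>

definition grid_line :: "nat \<Rightarrow> int \<times> int \<Rightarrow> (int \<times> int) set" where
  "grid_line r = (\<lambda>(v, w). (\<lambda>t. (t, w + t * v)) ` {0..<int r})"

definition plane_line :: "int \<times> int \<Rightarrow> (real ^ 2) set" where
  "plane_line = (\<lambda>(t, y). {z. z $ 2 = of_int t * z $ 1 + of_int y})"

lemma finite_grid_line: "finite (grid_line r l)"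
  by (cases l) (simp add: grid_line_def)

lemma card_grid_line_le: "card (grid_line r l) \<le> r"
proof -
  obtain v w where "l = (v, w)" by (cases l)
  then show ?thesis
    using card_image_le[of "{0..<int r}" "\<lambda>t. (t, w + t * v)"] by (simp add: grid_line_def)
qed

lemma grid_line_unique:
  assumes "x \<in> grid_line r l" "y \<in> grid_line r l" "x \<in> grid_line r l'" "y \<in> grid_line r l'" "x \<noteq> y"
  shows "l = l'"
proof -
  obtain v w v' w' where l: "l = (v, w)" "l' = (v', w')" by (cases l, cases l')
  obtain t u where tu: "x = (t, w + t * v)" "y = (u, w + u * v)" 
    using assms(1,2) by (auto simp: grid_line_def l)
  moreover have "w + t * v = w' + t * v'" "w + u * v = w' + u * v'"
    using assms(3,4) by (auto simp: grid_line_def l tu)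
  moreover from this have "(t - u) * (v - v') = 0" by (simp add: algebra_simps)
  ultimately have "v = v'" using assms(5) by auto
  with \<open>w + t * v = w' + t * v'\<close> show ?thesis by (simp add: l)
qed

text \<open>There is exactly one grid line for each slope \<open>v\<close>, with intercept
  \<open>y - t * v\<close>. The range of intercepts starts at \<open>- r * D\<close> so that none of
  these is lost.\<close>

lemma grid_lines_through_point:
  assumes "x \<in> {0..<int r} \<times> {0..<int M}"
  shows "card {l \<in> {0..<int D} \<times> {- int (r * D)..<int M}. x \<in> grid_line r l} = D"
proof -
  obtain t y where x: "x = (t, y)" by (cases x)
  have ty: "0 \<le> t" "t < int r" "0 \<le> y" "y < int M" using assms by (auto simp: x)
  have "{l \<in> {0..<int D} \<times> {- int (r * D)..<int M}. x \<in> grid_line r l} = (\<lambda>v. (v, y - t * v)) ` {0..<int D}"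
  proof (intro equalityI subsetI)
    fix l assume "l \<in> {l \<in> {0..<int D} \<times> {- int (r * D)..<int M}. x \<in> grid_line r l}"
    then show "l \<in> (\<lambda>v. (v, y - t * v)) ` {0..<int D}"
      by (auto simp: grid_line_def x)
  next
    fix l assume "l \<in> (\<lambda>v. (v, y - t * v)) ` {0..<int D}"
    then obtain v where v: "l = (v, y - t * v)" "0 \<le> v" "v < int D" by auto
    have "t * v \<le> int r * int D" using ty v by (intro mult_mono) auto
    moreover have "0 \<le> t * v" using ty v by simp
    ultimately have "- (int r * int D) \<le> y - t * v" "y - t * v < int M"
      using ty by linarith+
    then show "l \<in> {l \<in> {0..<int D} \<times> {- int (r * D)..<int M}. x \<in> grid_line r l}"
      using ty v by (auto simp: grid_line_def x)
  qed
  moreover have "inj_on (\<lambda>v. (v, y - t * v)) {0..<int D}" by (auto intro: inj_onI)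
  ultimately show ?thesis by (simp add: card_image)
qed

lemma is_line_plane_line: "is_line (plane_line x)"
proof -
  obtain t y where x: "x = (t, y)" by (cases x)
  let ?a = "vector [- of_int t, 1] :: real ^ 2"
  have eq: "plane_line x = {z. ?a \<bullet> z = of_int y}"
    by (auto simp: plane_line_def x inner_vec_def sum_2 vector_2)
  have "?a \<noteq> 0" by (metis vector_2(2) zero_index zero_neq_one)
  then show ?thesis
    unfolding is_line_def eq by (simp add: affine_hyperplane aff_dim_hyperplane)
qed

lemma plane_line_Int_unique:
  assumes "x \<noteq> y" "z \<in> plane_line x" "z \<in> plane_line y" "z' \<in> plane_line x" "z' \<in> plane_line y"
  shows "z = z'"
proof -
  obtain t a u b where xy: "x = (t, a)" "y = (u, b)" by (cases x, cases y)
  have e: "of_int t * z $ 1 + of_int a = of_int u * z $ 1 + of_int b"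
    "of_int t * z' $ 1 + of_int a = of_int u * z' $ 1 + of_int b"
    using assms(2-) by (auto simp: plane_line_def xy)
  then have "(of_int t - of_int u) * (z $ 1 - z' $ 1) = 0" by (simp add: algebra_simps)
  moreover have "t \<noteq> u" using e(1) assms(1) by (auto simp: xy)
  ultimately have "z $ 1 = z' $ 1" by simp
  moreover from this have "z $ 2 = z' $ 2" using assms(2,4) by (auto simp: plane_line_def xy)
  ultimately show ?thesis by (simp add: vec_eq_iff forall_2)
qed

lemma inj_plane_line: "inj plane_line"
proof (rule injI, rule ccontr)
  fix x y assume eq: "plane_line x = plane_line y" and ne: "x \<noteq> y"
  obtain t a where x: "x = (t, a)" by (cases x)
  let ?z = "vector [0, of_int a] :: real ^ 2" and ?z' = "vector [1, of_int t + of_int a] :: real ^ 2"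
  have "?z \<in> plane_line x" "?z' \<in> plane_line x" by (simp_all add: plane_line_def x vector_2)
  then have "?z = ?z'" using plane_line_Int_unique[OF ne] eq by blast
  then show False by (metis vector_2(1) zero_neq_one)
qed

lemma grid_line_concurrent:
  assumes "x \<in> grid_line r (v, w)"
  shows "vector [- of_int v, of_int w] \<in> plane_line x"
  using assms by (auto simp: grid_line_def plane_line_def vector_2)

section \<open>The random family of lines\<close>

text \<open>Here \<open>v\<close> is the number of points of the box. Hypothesis \<open>n\<close>
  gives enough phases to reach the container size \<open>m\<close>; \<open>p\<close> and
  \<open>b\<close> bound by 1/2 the probabilities of \<open>p\<close> choices inside one container
  and of more than \<open>b\<close> choices through one point, so some choice avoids both
  events.\<close>

lemma exists_line_family:
  fixes r R s k n N p b :: nat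
  defines "D \<equiv> R ^ k"
  defines "v \<equiv> r\<^sup>2 * D"
  assumes pos: "0 < r" "0 < R"
    and s: "2 * 2 ^ k * s \<le> D" "v \<le> 2 * s * R"
    and n: "(1 - 1 / (2 * 8 ^ k)) ^ n * real r \<le> 4 ^ Suc k"
    and p: "real ((v + 1) ^ (k * s * n)) * real (N choose p) * (4 ^ Suc k / real r) ^ p < 1 / 2"
    and b: "real (v\<^sup>2) * real (N choose Suc b) * (real r / real v) ^ Suc b < 1 / 2"
  shows "\<exists>F :: (real ^ 2) set set. finite F \<and> (\<forall>L\<in>F. is_line L) \<and> pq_property p (Suc k) F \<and>
    (\<forall>X. finite X \<and> pierces X F \<longrightarrow> N \<le> card X * b)"
proof -
  define M where "M = r * D"
  define V where "V = {0..<int r} \<times> {0..<int M}"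
  define \<Lambda> where "\<Lambda> = {0..<int D} \<times> {- int (r * D)..<int M}"
  \<comment> \<open>The least threshold that the container lemma permits:
    \<open>2 * 4 ^ k * card \<Lambda>\<close> equals \<open>m * R ^ k\<close>. It is the fraction
    \<open>4 ^ Suc k / r\<close> of the box.\<close>
  define m where "m = 4 ^ Suc k * M"
  have D0: "0 < D" using pos(2) by (simp add: D_def)
  have cardV: "card V = v"
    by (simp add: V_def card_cartesian_product) (simp add: v_def M_def power2_eq_square)
  have finV: "finite V" and V0: "V \<noteq> {}" and v0: "0 < v"
    using pos D0 by (auto simp: V_def v_def M_def)
  have "nat (int M - - int (r * D)) = 2 * M" unfolding M_def by linarith
  then have card\<Lambda>: "card \<Lambda> = 2 * M * D"
    by (simp only: \<Lambda>_def card_cartesian_product card_atLeastLessThan_int) simp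
  have "(8 :: nat) ^ k = 4 ^ k * 2 ^ k" by (simp flip: power_mult_distrib)
  then have "8 * 8 ^ k * s * r = 4 * 4 ^ k * (2 * 2 ^ k * s) * r" by simp
  also have "\<dots> \<le> 4 * 4 ^ k * D * r"
    using s(1) by (intro mult_le_mono) auto
  finally have "8 * 8 ^ k * s * r \<le> m" by (simp add: m_def M_def mult_ac)
  moreover have "2 * 4 ^ k * card \<Lambda> \<le> m * R ^ k"
    by (simp add: card\<Lambda> m_def flip: D_def)
  moreover have "card {l \<in> \<Lambda>. x \<in> grid_line r l} = R ^ k" if "x \<in> V" for x
    using grid_lines_through_point[of x r M D] that unfolding \<Lambda>_def V_def D_def by blast
  moreover have "finite \<Lambda>" by (simp add: \<Lambda>_def)
  ultimately have "covered V {I. I \<subseteq> V \<and> (\<forall>l\<in>\<Lambda>. card (I \<inter> grid_line r l) \<le> k)} ((card V + 1) ^ (k * s * n))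
    (max m ((1 - 1 / (2 * 8 ^ k)) ^ n * card V))"
    using finV s(2) unfolding cardV[symmetric]
    by (intro containers[where r = r and R = R, OF grid_line_unique card_grid_line_le finite_grid_line])
  moreover have "max m ((1 - 1 / (2 * 8 ^ k)) ^ n * card V) = m"
  proof -
    have "(1 - 1 / (2 * 8 ^ k)) ^ n * real r * real M \<le> 4 ^ Suc k * real M"
      using n by (intro mult_right_mono) auto
    then show ?thesis by (simp add: cardV v_def m_def M_def power2_eq_square mult_ac)
  qed
  ultimately obtain \<C> where \<C>: "finite \<C>" "card \<C> \<le> (v + 1) ^ (k * s * n)"
    "\<forall>C\<in>\<C>. C \<subseteq> V \<and> real (card C) \<le> m"
    "\<forall>I\<in>{I. I \<subseteq> V \<and> (\<forall>l\<in>\<Lambda>. card (I \<inter> grid_line r l) \<le> k)}. \<exists>C\<in>\<C>. I \<subseteq> C"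
    unfolding covered_def cardV by auto
  define thru where "thru = (\<lambda>z. {x \<in> V. z \<in> plane_line x})"
  \<comment> \<open>\<open>cross x x\<close> is some point of the line \<open>x\<close>, so that the sets \<open>thru (cross x y)\<close> also account for
    repeated choices of the same line.\<close>
  define cross where "cross = (\<lambda>x y. SOME z. z \<in> plane_line x \<and> z \<in> plane_line y)"
  define \<D> where "\<D> = (\<lambda>(x, y). thru (cross x y)) ` (V \<times> V)"
  \<comment> \<open>Distinct lines through a common point have distinct slopes, and only
    \<open>r\<close> slopes occur.\<close>
  have card_thru: "card (thru z) \<le> r" for z
  proof -
    have "inj_on fst (thru z)"
      by (rule inj_onI) (auto simp: thru_def plane_line_def)
    moreover have "fst ` thru z \<subseteq> {0..<int r}" by (auto simp: thru_def V_def)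
    ultimately have "card (thru z) \<le> card {0..<int r}" by (intro card_inj_on_le) auto
    then show ?thesis by simp
  qed
  have \<D>: "finite \<D>" "\<And>C. C \<in> \<D> \<Longrightarrow> C \<subseteq> V" "\<And>C. C \<in> \<D> \<Longrightarrow> real (card C) \<le> real r"
    using finV card_thru by (auto simp: \<D>_def) (auto simp: thru_def)
  have card\<D>: "card \<D> \<le> v\<^sup>2"
    using card_image_le[of "V \<times> V" "\<lambda>(x, y). thru (cross x y)"] finV
    by (simp add: \<D>_def card_cartesian_product cardV power2_eq_square)
  \<comment> \<open>This replaces an arbitrary point \<open>z\<close> of the plane by one of at most
    \<open>v\<^sup>2\<close> representatives, which makes the union bound finite. If two of the
    lines differ, the representative is \<open>z\<close> itself.\<close>
  have concurrent: "\<exists>C\<in>\<D>. f ` Q \<subseteq> C"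
    if fQ: "f ` Q \<subseteq> V" and Q: "Q \<noteq> {}" and z: "\<And>i. i \<in> Q \<Longrightarrow> z \<in> plane_line (f i)"
    for f :: "nat \<Rightarrow> int \<times> int" and Q z
  proof -
    obtain i where i: "i \<in> Q" using Q by blast
    have cross: "cross (f i) (f j) \<in> plane_line (f i) \<and> cross (f i) (f j) \<in> plane_line (f j)" if "j \<in> Q" for j
      unfolding cross_def by (rule someI[of _ z]) (use z i that in blast)
    have "\<exists>j\<in>Q. \<forall>l\<in>Q. cross (f i) (f j) \<in> plane_line (f l)"
    proof (cases "\<forall>j\<in>Q. f j = f i")
      case True
      then show ?thesis using cross i by metis
    next
      case False
      then obtain j where j: "j \<in> Q" "f i \<noteq> f j" by metis
      then have "cross (f i) (f j) = z"
        using plane_line_Int_unique[OF j(2)] cross[OF j(1)] z i by blast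
      then show ?thesis using j z by blast
    qed
    then obtain j where "j \<in> Q" "\<forall>l\<in>Q. cross (f i) (f j) \<in> plane_line (f l)" by blast
    moreover from this have "thru (cross (f i) (f j)) \<in> \<D>"
      using i fQ unfolding \<D>_def by (intro image_eqI[of _ _ "(f i, f j)"]) auto
    ultimately show ?thesis
      using fQ by (intro bexI[of _ "thru (cross (f i) (f j))"]) (auto simp: thru_def)
  qed
  let ?\<F> = "{..<N} \<rightarrow>\<^sub>E V"
  define Bad1 where "Bad1 = {f \<in> ?\<F>. \<exists>C\<in>\<C>. \<exists>P\<subseteq>{..<N}. card P = p \<and> f ` P \<subseteq> C}"
  define Bad2 where "Bad2 = {f \<in> ?\<F>. \<exists>C\<in>\<D>. \<exists>P\<subseteq>{..<N}. card P = Suc b \<and> f ` P \<subseteq> C}"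
  have vN: "0 < real v ^ N" using v0 by simp
  have mv: "real m / real v = 4 ^ Suc k / real r"
    using pos D0 by (simp add: m_def v_def M_def power2_eq_square field_simps)
  have "real (card Bad1) \<le> card \<C> * real (N choose p) * (real m / card V) ^ p * card V ^ N"
    unfolding Bad1_def using \<C>(1,3) finV V0 by (intro card_functions_hitting_le) auto
  also have "\<dots> = card \<C> * (real (N choose p) * (4 ^ Suc k / real r) ^ p) * real v ^ N"
    by (simp only: cardV mv of_nat_power mult.assoc)
  also have "\<dots> \<le> real ((v + 1) ^ (k * s * n)) * (real (N choose p) * (4 ^ Suc k / real r) ^ p) * real v ^ N"
    using \<C>(2) by (intro mult_right_mono of_nat_mono) auto
  also have "\<dots> < 1 / 2 * real v ^ N"
    using p vN by (intro mult_strict_right_mono) (simp_all add: mult.assoc)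
  finally have bad1: "real (card Bad1) < 1 / 2 * real v ^ N" .
  have "real (card Bad2) \<le> card \<D> * real (N choose Suc b) * (real r / card V) ^ Suc b * card V ^ N"
    unfolding Bad2_def using \<D> finV V0 by (intro card_functions_hitting_le) auto
  also have "\<dots> = card \<D> * (real (N choose Suc b) * (real r / real v) ^ Suc b) * real v ^ N"
    by (simp only: cardV of_nat_power mult.assoc)
  also have "\<dots> \<le> real (v\<^sup>2) * (real (N choose Suc b) * (real r / real v) ^ Suc b) * real v ^ N"
    using card\<D> by (intro mult_right_mono of_nat_mono) auto
  also have "\<dots> < 1 / 2 * real v ^ N"
    using b vN by (intro mult_strict_right_mono) (simp_all add: mult.assoc)
  finally have bad2: "real (card Bad2) < 1 / 2 * real v ^ N" .
  have fin\<F>: "finite ?\<F>" using finV by (intro finite_PiE) auto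
  have "card ?\<F> = v ^ N" by (simp add: card_PiE cardV)
  moreover have "real (card (Bad1 \<union> Bad2)) < real v ^ N"
    using bad1 bad2 of_nat_mono[OF card_Un_le[of Bad1 Bad2], where 'a = real] by (simp only: of_nat_add)
  then have "card (Bad1 \<union> Bad2) < v ^ N" by (metis of_nat_less_iff of_nat_power)
  ultimately have "\<not> ?\<F> \<subseteq> Bad1 \<union> Bad2"
    using card_mono[of "Bad1 \<union> Bad2" ?\<F>] fin\<F> by (auto simp: Bad1_def Bad2_def)
  then obtain f where f: "f \<in> ?\<F>" "f \<notin> Bad1" "f \<notin> Bad2" by blast
  have fV: "f i \<in> V" if "i < N" for i using f(1) that by auto
  define F where "F = (\<lambda>i. plane_line (f i)) ` {..<N}"
  show ?thesis
  proof (intro exI[of _ F] conjI allI impI ballI)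
    show "finite F" by (simp add: F_def)
    show "is_line L" if "L \<in> F" for L
      using that unfolding F_def by (auto simp del: split_paired_All intro: is_line_plane_line)
    show "pq_property p (Suc k) F"
      unfolding pq_property_def
    proof (intro allI impI)
      fix G assume G: "G \<subseteq> F" "finite G \<and> card G = p"
      \<comment> \<open>One index is picked for each line of \<open>G\<close>, so that
        \<open>P\<close> has exactly \<open>p\<close> elements even if lines were chosen
        repeatedly.\<close>
      obtain P where P: "P \<subseteq> {..<N}" "inj_on (\<lambda>i. plane_line (f i)) P" "G = (\<lambda>i. plane_line (f i)) ` P"
        using G(1) unfolding F_def subset_image_inj by blast
      have "card P = p" using P G(2) by (simp add: card_image)
      then have "\<not> (\<exists>C\<in>\<C>. f ` P \<subseteq> C)" using f(1,2) P(1) unfolding Bad1_def by blast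
      moreover have "f ` P \<subseteq> V" using fV P(1) by auto
      ultimately obtain l where l: "l \<in> \<Lambda>" "\<not> card (f ` P \<inter> grid_line r l) \<le> k"
        using \<C>(4) by blast
      then have "Suc k \<le> card (f ` P \<inter> grid_line r l)" by simp
      then obtain I where I: "I \<subseteq> f ` P \<inter> grid_line r l" "card I = Suc k"
        by (rule obtain_subset_with_card_n)
      obtain a c where ac: "l = (a, c)" by (cases l)
      show "\<exists>H\<subseteq>G. card H = Suc k \<and> \<Inter> H \<noteq> {}"
      proof (intro exI[of _ "plane_line ` I"] conjI)
        show "plane_line ` I \<subseteq> G" using I(1) P(3) by auto
        show "card (plane_line ` I) = Suc k"
          using I(2) inj_plane_line by (metis card_image inj_on_subset top_greatest)
        have "vector [- of_int a, of_int c] \<in> plane_line x" if "x \<in> I" for x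
          using grid_line_concurrent I(1) that ac by blast
        then show "\<Inter> (plane_line ` I) \<noteq> {}" by blast
      qed
    qed
    show "N \<le> card X * b" if X: "finite X \<and> pierces X F" for X
    proof -
      \<comment> \<open>Indices are counted instead of lines, so repeated choices cost nothing: all
        \<open>N\<close> indices have to be hit, at most \<open>b\<close> by each point.\<close>
      have "card {i \<in> {..<N}. z \<in> plane_line (f i)} \<le> b" for z
      proof (rule ccontr)
        assume "\<not> ?thesis"
        then have "Suc b \<le> card {i \<in> {..<N}. z \<in> plane_line (f i)}" by simp
        then obtain Q where Q: "Q \<subseteq> {i \<in> {..<N}. z \<in> plane_line (f i)}" "card Q = Suc b"
          by (rule obtain_subset_with_card_n)
        have "\<exists>C\<in>\<D>. f ` Q \<subseteq> C"
          by (rule concurrent[of f Q z]) (use Q fV in auto)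
        then show False using Q f(1,3) unfolding Bad2_def by blast
      qed
      then have "(\<Sum>z\<in>X. card {i \<in> {..<N}. z \<in> plane_line (f i)}) \<le> (\<Sum>z\<in>X. b)"
        by (rule sum_mono)
      moreover have "card (\<Union>z\<in>X. {i \<in> {..<N}. z \<in> plane_line (f i)})
          \<le> (\<Sum>z\<in>X. card {i \<in> {..<N}. z \<in> plane_line (f i)})"
        using X by (intro card_UN_le) auto
      moreover have "(\<Union>z\<in>X. {i \<in> {..<N}. z \<in> plane_line (f i)}) = {..<N}"
        using X by (fastforce simp: pierces_def F_def)
      ultimately show ?thesis by simp
    qed
  qed
qed

section \<open>Choice of the parameters\<close>

text \<open>The quotient of \<open>p ^ p\<close> by \<open>fact p\<close> is a single term of the
  series for \<open>exp p\<close>, and \<open>exp 1 \<le> 3\<close>.\<close>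

lemma power_le_fact_exp: "real p ^ p \<le> fact p * 3 ^ p"
proof -
  have "(\<Sum>n\<in>{p}. real p ^ n /\<^sub>R fact n) \<le> (\<Sum>n. real p ^ n /\<^sub>R fact n)"
    by (intro sum_le_suminf summable_exp_generic) auto
  then have "real p ^ p / fact p \<le> exp (real p * 1)"
    by (simp add: exp_def field_simps)
  also have "\<dots> = exp 1 ^ p" by (rule exp_of_nat_mult)
  also have "\<dots> \<le> 3 ^ p" by (intro power_mono exp_le) auto
  finally show ?thesis by (simp add: field_simps)
qed

lemma binomial_le_power_div: 
  assumes "0 < p"
  shows "real (N choose p) \<le> (3 * real N / real p) ^ p"
proof -
  have "real (N choose p) * real p ^ p \<le> real (N choose p) * (fact p * 3 ^ p)"
    by (intro mult_left_mono power_le_fact_exp) auto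
  also have "\<dots> = real ((N choose p) * fact p) * 3 ^ p" by simp
  also have "\<dots> \<le> real (N ^ p) * 3 ^ p"
    by (intro mult_right_mono of_nat_mono binomial_fact_pow) auto
  finally show ?thesis using assms by (simp add: power_divide power_mult_distrib field_simps)
qed

lemma one_minus_power_le_inverse:
  fixes x r :: real
  assumes "0 \<le> x" "x \<le> 1" "0 < r" "ln r \<le> x * real n"
  shows "(1 - x) ^ n * r \<le> 1"
proof -
  have "(1 - x) ^ n \<le> exp (- x) ^ n"
    using assms exp_ge_add_one_self[of "- x"] by (intro power_mono) auto
  also have "\<dots> = exp (- (x * real n))" by (simp add: mult.commute flip: exp_of_nat_mult)
  also have "\<dots> \<le> exp (- ln r)" using assms by simp
  finally have "(1 - x) ^ n \<le> inverse r" using assms(3) by (simp add: exp_minus)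
  then have "(1 - x) ^ n * r \<le> inverse r * r" using assms(3) by (intro mult_right_mono) auto
  then show ?thesis using assms(3) by simp
qed

text \<open>The choice is \<open>r = \<rho> ^ 10\<close> and \<open>R = \<rho> ^ 22\<close>, hence
  \<open>D = \<rho> ^ (22 * k)\<close> and \<open>v = \<rho> ^ (22 * k + 20)\<close>; then
  \<open>s = v / R\<close>, which is \<open>D / \<rho> ^ 2\<close>. The number of choices is
  \<open>r * D / \<rho>\<close>, where the lost factor \<open>\<rho>\<close> keeps the multiplicity
  \<open>b\<close> linear in \<open>k\<close>.\<close>

lemma exists_line_family_powers:
  fixes \<rho> k p :: nat
  assumes k: "2 \<le> k" and \<rho>: "3 \<le> \<rho>"
    and p: "12 * 4 ^ Suc k * \<rho> ^ (22 * k - 1) \<le> p"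
    and log: "22 * real k ^ 2 * 2 ^ k * ln (real \<rho>) ^ 2 \<le> real \<rho>"
  shows "\<exists>F :: (real ^ 2) set set. finite F \<and> (\<forall>L\<in>F. is_line L) \<and> pq_property p (Suc k) F \<and>
    (\<forall>X. finite X \<and> pierces X F \<longrightarrow> \<rho> ^ (22 * k + 9) \<le> card X * (44 * k + 40))"
proof -
  define n where "n = nat \<lceil>2 * 8 ^ k * ln (real (\<rho> ^ 10))\<rceil>"
  define s where "s = \<rho> ^ (22 * k - 2)"
  define v where "v = (\<rho> ^ 10)\<^sup>2 * (\<rho> ^ 22) ^ k"
  let ?L = "ln (real \<rho>)"
  have "exp 1 \<le> real \<rho>" using \<rho> exp_le by linarith
  then have L1: "1 \<le> ?L" using \<rho> by (subst ln_ge_iff) auto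
  then have L2: "1 \<le> ?L ^ 2" by simp
  have \<rho>0: "0 < real \<rho>" using \<rho> by simp
  have v: "v = \<rho> ^ (22 * k + 20)" by (simp add: v_def power_add flip: power_mult)
  have s\<rho>: "s * \<rho> ^ 2 = \<rho> ^ (22 * k)" "s * \<rho> = \<rho> ^ (22 * k - 1)"
  proof -
    have "22 * k = (22 * k - 2) + 2" "22 * k - 1 = Suc (22 * k - 2)" using k by simp_all
    then show "s * \<rho> ^ 2 = \<rho> ^ (22 * k)" "s * \<rho> = \<rho> ^ (22 * k - 1)"
      unfolding s_def by (metis power_add, metis power_Suc2)
  qed
  have ln\<rho>10: "ln (real (\<rho> ^ 10)) = 10 * ?L" using \<rho>0 by (simp add: ln_realpow)
  have "real (2 * 2 ^ k) = 1 * 2 * 2 ^ k * 1" by simp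
  also have "\<dots> \<le> real k ^ 2 * 22 * 2 ^ k * ?L ^ 2"
    using L2 k by (intro mult_mono) auto
  also have "\<dots> \<le> real \<rho>" using log by (simp add: mult_ac)
  finally have two: "2 * 2 ^ k \<le> \<rho>" by linarith
  have p_pos: "2 \<le> p"
  proof -
    have "1 \<le> 4 ^ Suc k * \<rho> ^ (22 * k - 1)" using \<rho> by simp
    then show ?thesis using p by linarith
  qed
  have s1: "2 * 2 ^ k * s \<le> (\<rho> ^ 22) ^ k"
  proof -
    have "2 * 2 ^ k \<le> \<rho> ^ 2" using two \<rho> by (simp add: power2_eq_square) (meson le_square le_trans)
    then have "2 * 2 ^ k * s \<le> \<rho> ^ 2 * s" by (rule mult_le_mono1)
    then show ?thesis using s\<rho>(1) by (simp add: mult_ac flip: power_mult)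
  qed
  have s2: "v \<le> 2 * s * \<rho> ^ 22"
  proof -
    have "v = \<rho> ^ (22 * k) * \<rho> ^ 20" by (simp add: v power_add)
    also have "\<dots> = s * \<rho> ^ 2 * \<rho> ^ 20" by (simp only: s\<rho>(1))
    also have "\<dots> = s * \<rho> ^ 22" by (simp add: mult.assoc flip: power_add)
    finally show ?thesis by simp
  qed
  have n1: "(1 - 1 / (2 * 8 ^ k)) ^ n * real (\<rho> ^ 10) \<le> 4 ^ Suc k"
  proof -
    have "1 \<le> (8 :: real) ^ k" by (rule one_le_power) simp
    then have "1 \<le> 2 * (8 :: real) ^ k" by linarith
    moreover have "2 * 8 ^ k * ln (real (\<rho> ^ 10)) \<le> real n"
      unfolding n_def by linarith
    ultimately have "(1 - 1 / (2 * 8 ^ k)) ^ n * real (\<rho> ^ 10) \<le> 1"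
      using \<rho> by (intro one_minus_power_le_inverse) (auto simp: field_simps)
    also have "1 \<le> (4 :: real) ^ Suc k" by (rule one_le_power) simp
    finally show ?thesis .
  qed
  \<comment> \<open>There are at most \<open>2 ^ p\<close> containers, and the expected number of
    \<open>p\<close>-sets of positions falling into a fixed one is at most
    \<open>(1 / 4) ^ p\<close>.\<close>
  have p1: "real ((v + 1) ^ (k * s * n)) * real (\<rho> ^ (22 * k + 9) choose p) * (4 ^ Suc k / real (\<rho> ^ 10)) ^ p < 1 / 2"
  proof -
    have "real n \<le> 2 * 8 ^ k * (10 * ?L) + 1"
      using L1 unfolding n_def ln\<rho>10 by simp
    also have "1 \<le> (8 :: real) ^ k * ?L"
      using mult_mono[of 1 "(8 :: real) ^ k" 1 ?L] L1 by simp
    finally have n: "real n \<le> 21 * 8 ^ k * ?L" by (simp add: mult_ac)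
    have "v + 1 \<le> \<rho> ^ (22 * k + 21)"
    proof -
      have "1 \<le> v" using \<rho> by (simp add: v)
      then have "v + 1 \<le> 3 * v" by simp
      also have "\<dots> \<le> \<rho> * v" using \<rho> by (rule mult_le_mono1)
      also have "\<rho> * v = \<rho> ^ (22 * k + 21)" by (simp add: v add.commute flip: power_Suc)
      finally show ?thesis .
    qed
    then have "real (v + 1) \<le> real (\<rho> ^ (22 * k + 21))" by (rule of_nat_mono)
    then have "ln (real (v + 1)) \<le> ln (real (\<rho> ^ (22 * k + 21)))"
      by (subst ln_le_cancel_iff) (use \<rho> in auto)
    also have "\<dots> = real (22 * k + 21) * ?L" using \<rho>0 by (simp add: ln_realpow)
    also have "\<dots> \<le> real (33 * k) * ?L" using k L1 by (intro mult_right_mono) auto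
    finally have lnv: "ln (real (v + 1)) \<le> 33 * real k * ?L" by simp
    \<comment> \<open>The constants fit because \<open>21 * 33 = 63 / 2 * 22\<close> and
      \<open>63 / 2 \<le> 32\<close>, where \<open>32 * 4 ^ k = 2 / 3 * 12 * 4 ^ Suc k\<close>;
      finally \<open>2 / 3 \<le> ln 2\<close>.\<close>
    have "real (k * s * n) * ln (real (v + 1)) = real k * real s * real n * ln (real (v + 1))" by simp
    also have "\<dots> \<le> real k * real s * (21 * 8 ^ k * ?L) * (33 * real k * ?L)"
      using n lnv L1 by (intro mult_mono) auto
    also have "\<dots> = (63 / 2) * real s * 4 ^ k * (22 * real k ^ 2 * 2 ^ k * ?L ^ 2)"
    proof -
      have "(8 :: real) ^ k = 4 ^ k * 2 ^ k" by (simp flip: power_mult_distrib)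
      then show ?thesis by (simp add: power2_eq_square)
    qed
    also have "\<dots> \<le> (63 / 2) * real s * 4 ^ k * real \<rho>"
      using log by (intro mult_left_mono) auto
    also have "\<dots> \<le> (2 / 3) * (12 * 4 ^ Suc k * (real s * real \<rho>))" by simp
    also have "12 * 4 ^ Suc k * (real s * real \<rho>) \<le> real p"
      using of_nat_mono[OF p, where 'a = real] by (simp only: of_nat_mult s\<rho>(2)[symmetric] of_nat_power of_nat_numeral)
    also have "2 / 3 * real p \<le> real p * ln 2"
      using mult_left_mono[OF ln2_ge_two_thirds, of "real p"] by simp
    finally have "real (k * s * n) * ln (real (v + 1)) \<le> real p * ln 2" by simp
    then have "ln (real (v + 1) ^ (k * s * n)) \<le> ln (2 ^ p)"
      by (simp add: ln_realpow del: of_nat_mult)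
    then have 1: "real ((v + 1) ^ (k * s * n)) \<le> 2 ^ p"
      by (subst (asm) ln_le_cancel_iff) auto
    have "real (\<rho> ^ (22 * k + 9) choose p) * (4 ^ Suc k / real (\<rho> ^ 10)) ^ p
       \<le> (3 * real (\<rho> ^ (22 * k + 9)) / real p) ^ p * (4 ^ Suc k / real (\<rho> ^ 10)) ^ p"
      using p_pos by (intro mult_right_mono binomial_le_power_div) auto
    also have "\<dots> = (3 * real (\<rho> ^ (22 * k + 9)) / real p * (4 ^ Suc k / real (\<rho> ^ 10))) ^ p"
      by (rule power_mult_distrib[symmetric])
    also have "\<dots> \<le> (1 / 4) ^ p"
    proof (rule power_mono)
      have "\<rho> ^ (22 * k + 9) = \<rho> ^ (22 * k - 1) * \<rho> ^ 10"
        using k by (simp add: add.commute flip: power_add)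
      moreover have "12 * 4 ^ Suc k * real (\<rho> ^ (22 * k - 1)) \<le> real p"
        using of_nat_mono[OF p, where 'a = real] by simp
      ultimately show "3 * real (\<rho> ^ (22 * k + 9)) / real p * (4 ^ Suc k / real (\<rho> ^ 10)) \<le> 1 / 4"
        using p_pos \<rho>0 by (simp add: field_simps)
    qed auto
    finally have 2: "real (\<rho> ^ (22 * k + 9) choose p) * (4 ^ Suc k / real (\<rho> ^ 10)) ^ p \<le> (1 / 4) ^ p" .
    have "real ((v + 1) ^ (k * s * n)) * (real (\<rho> ^ (22 * k + 9) choose p) * (4 ^ Suc k / real (\<rho> ^ 10)) ^ p)
      \<le> 2 ^ p * (1 / 4) ^ p"
      by (rule mult_mono[OF 1 2]) auto
    also have "\<dots> = (1 / 2 :: real) ^ p" by (simp flip: power_mult_distrib)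
    also have "\<dots> \<le> (1 / 2) ^ 2" using p_pos by (intro power_decreasing) auto
    also have "\<dots> < (1 / 2 :: real)" by (simp add: power2_eq_square)
    finally show ?thesis by (simp only: mult.assoc)
  qed
  \<comment> \<open>With \<open>N\<close> the number of choices,
    \<open>N * r / v = 1 / \<rho>\<close>. Since \<open>v\<^sup>2 = \<rho> ^ (44 * k + 40)\<close>,
    one factor more than this exponent makes the whole product at most
    \<open>1 / \<rho>\<close>.\<close>
  have b1: "real (v\<^sup>2) * real (\<rho> ^ (22 * k + 9) choose Suc (44 * k + 40)) *
      (real (\<rho> ^ 10) / real v) ^ Suc (44 * k + 40) < 1 / 2"
  proof -
    let ?b = "Suc (44 * k + 40)"
    have vv: "real (v\<^sup>2) = real \<rho> ^ (44 * k + 40)"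
      by (simp add: v flip: power_mult)
    have "real (\<rho> ^ (22 * k + 9) choose ?b) \<le> real ((\<rho> ^ (22 * k + 9)) ^ ?b)"
      by (intro of_nat_mono order_trans[OF _ binomial_fact_pow]) simp
    then have "real (v\<^sup>2) * real (\<rho> ^ (22 * k + 9) choose ?b) * (real (\<rho> ^ 10) / real v) ^ ?b
        \<le> real (v\<^sup>2) * real (\<rho> ^ (22 * k + 9)) ^ ?b * (real (\<rho> ^ 10) / real v) ^ ?b"
      by (intro mult_right_mono mult_left_mono) auto
    also have "\<dots> = real (v\<^sup>2) * (real (\<rho> ^ (22 * k + 9)) * (real (\<rho> ^ 10) / real v)) ^ ?b"
      by (simp only: power_mult_distrib mult.assoc)
    also have "real (\<rho> ^ (22 * k + 9)) * (real (\<rho> ^ 10) / real v) = 1 / real \<rho>"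
      using \<rho>0 by (simp add: v field_simps flip: power_add power_Suc)
    also have "real (v\<^sup>2) * (1 / real \<rho>) ^ ?b = 1 / real \<rho>"
      using \<rho>0 unfolding vv by (subst power_Suc) (simp add: power_divide)
    also have "\<dots> < 1 / 2" using \<rho> by (simp add: field_simps)
    finally show ?thesis .
  qed
  show ?thesis
    by (rule exists_line_family[where k = k and r = "\<rho> ^ 10" and R = "\<rho> ^ 22" and s = s and n = n, folded v_def, OF _ _ s1 s2 n1 p1 b1])
      (use \<rho> in auto)
qed

section \<open>Lifting planar families to higher dimension\<close>

text \<open>The sets are pulled back along a surjective projection to two coordinates. This
  preserves convexity and nonempty intersections, and the image of a piercing set of the cylinders
  pierces \<open>F\<close>.\<close>

lemma HD_ge_of_planar_family:
  fixes F :: "(real ^ 2) set set"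
  assumes dim: "CARD('d::finite) \<ge> 2"
    and F: "finite F" "\<And>S. S \<in> F \<Longrightarrow> convex S" "\<And>S. S \<in> F \<Longrightarrow> S \<noteq> {}" "pq_property p q F"
    and X: "\<And>X. finite X \<Longrightarrow> pierces X F \<Longrightarrow> B \<le> real (card X)"
  shows "ereal B \<le> ereal_of_enat (HD TYPE('d) p q)"
proof -
  have "\<exists>i j :: 'd. i \<noteq> j"
    using dim by (metis (full_types) UNIV_I card_le_Suc0_iff_eq finite not_less_eq_eq numeral_2_eq_2)
  then obtain i j :: 'd where ij: "i \<noteq> j" by blast
  define \<pi> :: "real ^ 'd \<Rightarrow> real ^ 2" where "\<pi> = (\<lambda>x. vector [x $ i, x $ j])"
  have lin: "linear \<pi>"
    by (rule linearI) (simp_all add: \<pi>_def vec_eq_iff forall_2 vector_2)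
  have surj: "surj \<pi>"
  proof (rule surjI[where f = "\<lambda>z. \<chi> l. if l = i then z $ 1 else z $ 2"])
    show "\<pi> (\<chi> l. if l = i then z $ 1 else z $ 2) = z" for z
      using ij by (simp add: \<pi>_def vec_eq_iff forall_2 vector_2)
  qed
  have inj: "inj_on ((-`) \<pi>) A" for A
    using surj by (intro inj_onI) (metis surj_image_vimage_eq)
  define F' where "F' = (-`) \<pi> ` F"
  have F': "finite F'" "\<forall>S\<in>F'. convex S \<and> S \<noteq> {}"
  proof -
    show "finite F'" using F(1) by (simp add: F'_def)
    show "\<forall>S\<in>F'. convex S \<and> S \<noteq> {}"
      using F(2,3) convex_linear_vimage[OF lin] surj by (auto simp: F'_def) (metis surj_image_vimage_eq image_empty)
  qed
  have pq': "pq_property p q F'"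
    unfolding pq_property_def
  proof (intro allI impI)
    fix G assume G: "G \<subseteq> F'" "finite G \<and> card G = p"
    obtain A where A: "A \<subseteq> F" "G = (-`) \<pi> ` A" using G(1) unfolding F'_def by (metis subset_image_iff)
    have "finite A" "card A = p" using A G inj card_image finite_subset F(1) by metis+
    then obtain H where H: "H \<subseteq> A" "card H = q" "\<Inter>H \<noteq> {}"
      using F(4) A(1) unfolding pq_property_def by blast
    obtain z where "z \<in> \<Inter>H" using H(3) by blast
    moreover obtain x where "\<pi> x = z" using surj by (metis surjD)
    ultimately have "x \<in> \<Inter>((-`) \<pi> ` H)" by auto
    then have "\<Inter>((-`) \<pi> ` H) \<noteq> {}" by (metis emptyE)
    moreover have "card ((-`) \<pi> ` H) = q" using H(2) inj by (simp add: card_image)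
    moreover have "(-`) \<pi> ` H \<subseteq> G" using A(2) H(1) by auto
    ultimately show "\<exists>H\<subseteq>G. card H = q \<and> \<Inter> H \<noteq> {}"
      by (intro exI[of _ "(-`) \<pi> ` H"] conjI)
  qed
  have pierce: "B \<le> real (card Y)" if "finite Y" "pierces Y F'" for Y
  proof -
    have "pierces (\<pi> ` Y) F" using that(2) by (fastforce simp: pierces_def F'_def)
    then have "B \<le> real (card (\<pi> ` Y))" using X that(1) by blast
    also have "\<dots> \<le> real (card Y)" using that(1) by (simp add: card_image_le)
    finally show ?thesis .
  qed
  define S where "S = {c. \<forall>F :: (real ^ 'd) set set.
      finite F \<and> (\<forall>S\<in>F. convex S \<and> S \<noteq> {}) \<and> pq_property p q F \<longrightarrow>
      (\<exists>X. finite X \<and> card X \<le> c \<and> pierces X F)}"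
  have HD: "HD TYPE('d) p q = Inf (enat ` S)" by (simp add: HD_def S_def)
  show ?thesis
  \<comment> \<open>Over the empty set the infimum in \<open>enat\<close> is infinite; otherwise it
    is attained.\<close>
  proof (cases "S = {}")
    case True
    then show ?thesis by (simp add: HD Inf_enat_def)
  next
    case False
    then obtain a where "enat a \<in> enat ` S" by blast
    then have "(LEAST x. x \<in> enat ` S) \<in> enat ` S" by (rule LeastI)
    moreover have "HD TYPE('d) p q = (LEAST x. x \<in> enat ` S)"
      using False unfolding HD Inf_enat_def by simp
    ultimately have "HD TYPE('d) p q \<in> enat ` S" by metis
    then obtain c where c: "c \<in> S" "HD TYPE('d) p q = enat c" by blast
    have "\<exists>Y. finite Y \<and> card Y \<le> c \<and> pierces Y F'"
      by (rule c(1)[unfolded S_def mem_Collect_eq, THEN spec, of F', THEN mp]) (intro conjI F' pq')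
    then obtain Y where "finite Y" "card Y \<le> c" "pierces Y F'" by blast
    then have "B \<le> real c" using pierce[of Y] by linarith
    then show ?thesis by (simp add: c(2))
  qed
qed

section \<open>The scale belonging to a given \<open>p\<close>, and its size\<close>

lemma exists_power_scale:
  fixes p K :: nat
  assumes "2 \<le> p" "0 < K"
  obtains \<rho> where "2 \<le> \<rho>" "p \<le> \<rho> ^ K" "(\<rho> - 1) ^ K < p" "\<rho> \<le> p"
proof -
  have self: "p \<le> p ^ K" using assms by (simp add: self_le_power)
  define \<rho> where "\<rho> = (LEAST \<rho>. p \<le> \<rho> ^ K)"
  have 1: "p \<le> \<rho> ^ K" unfolding \<rho>_def using self by (rule LeastI)
  have 2: "\<rho> \<le> p" unfolding \<rho>_def using self by (rule Least_le)
  have "\<rho> \<noteq> 0" using 1 assms by (cases "\<rho> = 0") (simp_all add: power_0_left)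
  moreover have "\<rho> \<noteq> 1" using 1 assms by (cases "\<rho> = 1") simp_all
  ultimately have 3: "2 \<le> \<rho>" by simp
  have "\<not> p \<le> (\<rho> - 1) ^ K" using 3 not_less_Least[of "\<rho> - 1" "\<lambda>\<rho>. p \<le> \<rho> ^ K"] by (simp add: \<rho>_def)
  then show ?thesis using that 1 2 3 by simp
qed

text \<open>Since \<open>0.01 * \<eta> \<le> 1 / 200\<close>, cubing the range condition gives the
  second claim. It needs \<open>ln (ln p)\<close> positive, which \<open>p \<ge> 3\<close> yields
  with the crude value 0.08; the second claim then improves this to 1.\<close>

lemma ln_ge_of_range:
  fixes \<eta> :: real and p k :: nat
  assumes "0 < \<eta>" "\<eta> < 1/2" "3 \<le> p" "2 \<le> k"
    and "real (Suc k) \<le> 0.01 * \<eta> * (ln (real p) / ln (ln (real p))) powr (1/3)"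
  shows "1 \<le> ln (ln (real p))" "(200 * real k) ^ 3 * ln (ln (real p)) \<le> ln (real p)"
proof -
  let ?T = "ln (real p)"
  have "ln (3 :: real) = 1 + ln (3 / exp 1)" by (simp add: ln_div)
  moreover have "1 - 1 / (3 / exp 1) \<le> ln (3 / exp 1 :: real)"
    using ln_add_one_self_le_self2[of "exp 1 / 3 - 1 :: real"] by (simp add: ln_div)
  moreover have "exp 1 < (272 / 100 :: real)" by (rule e_less_272)
  moreover have "ln 3 \<le> ?T" using assms(3) by simp
  ultimately have T1: "1.09 \<le> ?T" by simp
  have "1 - 1 / ?T \<le> ln ?T"
    using ln_add_one_self_le_self2[of "1 / ?T - 1"] T1 by (simp add: ln_div)
  moreover have "1 / ?T \<le> 1 / 1.09" using T1 by (intro divide_left_mono) auto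
  ultimately have lnT0: "0.08 \<le> ln ?T" by simp
  let ?Q = "(?T / ln ?T) powr (1/3)"
  have "0.01 * \<eta> * ?Q \<le> 1 / 200 * ?Q" using assms(2) by (intro mult_right_mono) auto
  then have "200 * real k \<le> ?Q" using assms(5) by simp
  then have "(200 * real k) ^ 3 \<le> ?Q ^ 3" by (intro power_mono) auto
  also have "\<dots> = ?T / ln ?T"
    using T1 lnT0 by (simp add: powr_powr flip: powr_realpow')
  finally show main: "(200 * real k) ^ 3 * ln ?T \<le> ?T"
    using lnT0 by (simp add: field_simps)
  have "400 ^ 3 * 0.08 \<le> (200 * real k) ^ 3 * ln ?T"
    using assms(4) lnT0 by (intro mult_mono power_mono) auto
  also note main
  finally have "3 \<le> ?T" by simp
  then show "1 \<le> ln ?T" using T1 exp_le by (subst ln_ge_iff) auto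
qed

text \<open>Makes \<open>\<rho>\<close> large enough to absorb every lower order loss, each being a
  power of \<open>ln p\<close> with exponent at most \<open>k + 15\<close>. It combines
  \<open>ln \<rho> \<ge> ln p / (22 * k)\<close> with
  \<open>ln p \<ge> 22 * k * (k + 15) * ln (ln p)\<close>.\<close>

lemma scale_large:
  fixes k p \<rho> :: nat
  assumes k: "2 \<le> k" and p: "3 \<le> p" and T: "1 \<le> ln (ln (real p))" "(200 * real k) ^ 3 * ln (ln (real p)) \<le> ln (real p)"
    and \<rho>: "2 \<le> \<rho>" "p \<le> \<rho> ^ (22 * k)"
  shows "ln (real p) ^ (k + 15) \<le> real \<rho>"
proof -
  let ?T = "ln (real p)"
  have "ln 1 < ?T" using p by (subst ln_less_cancel_iff) auto
  then have T0: "0 < ?T" by simp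
  have "real p \<le> real (\<rho> ^ (22 * k))" using \<rho>(2) by (rule of_nat_mono)
  then have "?T \<le> ln (real \<rho> ^ (22 * k))" using p \<rho>(1) by simp
  also have "\<dots> = 22 * real k * ln (real \<rho>)" using \<rho>(1) by (simp add: ln_realpow)
  finally have up: "?T \<le> 22 * real k * ln (real \<rho>)" .
  have "22 * real k * real (k + 15) \<le> (200 * real k) ^ 3"
  proof -
    have 1: "real (k + 15) \<le> 200 * real k" using k by simp
    have 2: "22 * real k \<le> 200 * real k * (200 * real k)" using k by (simp add: mult_mono)
    have "22 * real k * real (k + 15) \<le> (200 * real k * (200 * real k)) * (200 * real k)"
      by (rule mult_mono[OF 2 1]) simp_all
    then show ?thesis by (simp add: power3_eq_cube)
  qed
  then have "22 * real k * real (k + 15) * ln ?T \<le> (200 * real k) ^ 3 * ln ?T"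
    using T(1) by (intro mult_right_mono) auto
  also note T(2)
  also note up
  finally have "22 * real k * (real (k + 15) * ln ?T) \<le> 22 * real k * ln (real \<rho>)" by (simp only: mult.assoc)
  then have "real (k + 15) * ln ?T \<le> ln (real \<rho>)" using k by simp
  then have "ln (?T ^ (k + 15)) \<le> ln (real \<rho>)" using T0 by (simp add: ln_realpow)
  then show ?thesis using T0 \<rho>(1) by (subst (asm) ln_le_cancel_iff) auto
qed

text \<open>Bernoulli's inequality for \<open>(1 - 1 / \<rho>) ^ K\<close>. For the least
  \<open>\<rho>\<close> with \<open>p \<le> \<rho> ^ K\<close> it shows that rounding up to a power
  costs at most a factor 2.\<close>

lemma half_power_le_pred_power:
  assumes "2 * K \<le> \<rho>" "2 \<le> (\<rho> :: nat)"
  shows "\<rho> ^ K \<le> 2 * (\<rho> - 1) ^ K"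
proof -
  have "1 / 2 \<le> 1 + real K * (- 1 / real \<rho>)" using assms by (simp add: field_simps flip: of_nat_mult)
  also have "\<dots> \<le> (1 + (- 1 / real \<rho>)) ^ K"
    using assms by (intro Bernoulli_inequality) (simp add: field_simps)
  also have "1 + (- 1 / real \<rho>) = real (\<rho> - 1) / real \<rho>" using assms by (simp add: field_simps of_nat_diff)
  finally have "real \<rho> ^ K \<le> 2 * real (\<rho> - 1) ^ K" using assms by (simp add: power_divide field_simps)
  then have "real (\<rho> ^ K) \<le> real (2 * (\<rho> - 1) ^ K)" by simp
  then show ?thesis by linarith
qed

theorem theorem1p1:
  fixes \<eta> :: real and p q :: nat
  assumes "0 < \<eta>" and "\<eta> < 1/2"
    and "p \<ge> 3" and "q \<ge> 3"
    and "real q \<le> 0.01 * \<eta> * (ln (real p) / ln (ln (real p))) powr (1/3)"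
  shows "(\<exists>F :: (real ^ 2) set set.
            finite F \<and> (\<forall>L\<in>F. is_line L) \<and> pq_property p q F \<and>
            \<not> (\<exists>X. finite X \<and> pierces X F \<and>
                  real (card X) < real p powr (1 + (1 - \<eta>) / (4 * real q - 7))))
       \<and> (CARD('d::finite) \<ge> 2 \<and> q \<ge> CARD('d) + 1 \<longrightarrow>
            ereal_of_enat (HD TYPE('d) p q)
              \<ge> ereal (real p powr (1 + (1 - \<eta>) / (4 * real q - 7))))"
proof -
  define k where "k = q - 1"
  have q: "q = Suc k" and k: "2 \<le> k" using assms(4) by (auto simp: k_def)
  let ?T = "ln (real p)" and ?e = "1 + (1 - \<eta>) / (4 * real q - 7)"
  have T: "1 \<le> ln ?T" "(200 * real k) ^ 3 * ln ?T \<le> ?T"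
    using ln_ge_of_range[OF assms(1-3) k] assms(5) unfolding q by auto
  obtain \<rho> where \<rho>: "2 \<le> \<rho>" "p \<le> \<rho> ^ (22 * k)" "(\<rho> - 1) ^ (22 * k) < p" "\<rho> \<le> p"
    using exists_power_scale[of p "22 * k"] assms(3) k by auto
  have T\<rho>: "?T ^ (k + 15) \<le> real \<rho>" using scale_large[OF k assms(3) T \<rho>(1,2)] .
  have "(200 * real k) ^ 1 \<le> (200 * real k) ^ 3"
    using k by (intro power_increasing) auto
  then have "(200 * real k) ^ 1 * 1 \<le> (200 * real k) ^ 3 * ln ?T"
    using T(1) by (rule mult_mono) simp_all
  also note T(2)
  finally have kT: "200 * real k \<le> ?T" by simp
  with k have T400: "400 \<le> ?T" by simp
  have le_\<rho>: "x \<le> real \<rho>" if "x \<le> ?T ^ m" "m \<le> k + 15" for x m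
    using that T\<rho> T400 power_increasing[of m "k + 15" ?T] by linarith
  have pow_le: "a ^ m \<le> ?T ^ m" if "0 \<le> a" "a \<le> 400" for a m
    using that T400 by (intro power_mono) auto
  have "22 * real k ^ 2 * 2 ^ k * ln (real \<rho>) ^ 2 \<le> ?T * ?T ^ 2 * ?T ^ k * ?T ^ 2"
  proof -
    have "ln (real \<rho>) \<le> ?T" "0 \<le> ln (real \<rho>)" using \<rho>(1,4) by auto
    then show ?thesis
      using kT T400 pow_le[of 2 k] by (intro mult_mono power_mono) auto
  qed
  also have "\<dots> = ?T ^ (k + 5)" by (simp add: power_add power2_eq_square eval_nat_numeral)
  finally have log: "22 * real k ^ 2 * 2 ^ k * ln (real \<rho>) ^ 2 \<le> real \<rho>"
    by (rule le_\<rho>) simp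
  have "44 * real k \<le> ?T ^ 1" using kT by simp
  then have "44 * real k \<le> real \<rho>" by (rule le_\<rho>) simp
  then have "\<rho> ^ (22 * k) \<le> 2 * (\<rho> - 1) ^ (22 * k)"
    using \<rho>(1) by (intro half_power_le_pred_power) simp_all
  then have half: "\<rho> ^ (22 * k) \<le> 2 * p" using \<rho>(3) by linarith
  have "24 * 4 ^ Suc k \<le> ?T ^ 1 * ?T ^ Suc k"
    using T400 pow_le[of 4 "Suc k"] by (intro mult_mono) auto
  also have "\<dots> = ?T ^ (k + 2)" by simp
  finally have "24 * 4 ^ Suc k \<le> real \<rho>" by (rule le_\<rho>) simp
  then have "real (24 * 4 ^ Suc k) \<le> real \<rho>" by simp
  then have "24 * 4 ^ Suc k \<le> \<rho>" by linarith
  then have "24 * 4 ^ Suc k * \<rho> ^ (22 * k - 1) \<le> \<rho> * \<rho> ^ (22 * k - 1)" by (rule mult_le_mono1)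
  also have "\<dots> = \<rho> ^ (22 * k)" using k by (simp flip: power_Suc)
  finally have p': "12 * 4 ^ Suc k * \<rho> ^ (22 * k - 1) \<le> p" using half by simp
  have "400 \<le> ?T ^ 1" using T400 by simp
  then have "400 \<le> real \<rho>" by (rule le_\<rho>) simp
  then have \<rho>3: "3 \<le> \<rho>" by simp
  obtain F :: "(real ^ 2) set set" where F: "finite F" "\<forall>L\<in>F. is_line L" "pq_property p q F"
    and F_pierce: "\<And>X. finite X \<Longrightarrow> pierces X F \<Longrightarrow> \<rho> ^ (22 * k + 9) \<le> card X * (44 * k + 40)"
    using exists_line_family_powers[OF k \<rho>3 p' log] unfolding q by blast
  have bound: "real p powr ?e \<le> real (card X)" if X: "finite X" "pierces X F" for X
  proof -
    have x0: "0 < 4 * real k - 3" using k by simp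
    have "?e \<le> 1 + 1 / (4 * real k - 3)"
      using assms(1) x0 by (simp add: q divide_right_mono)
    then have "real p powr ?e \<le> real p powr (1 + 1 / (4 * real k - 3))"
      using assms(3) by (intro powr_mono) auto
    also have "\<dots> \<le> real (\<rho> ^ (22 * k)) powr (1 + 1 / (4 * real k - 3))"
      using \<rho>(2) x0 by (intro powr_mono2 of_nat_mono) auto
    also have "\<dots> = real \<rho> powr (22 * real k * (1 + 1 / (4 * real k - 3)))"
      using \<rho>(1) by (simp add: powr_powr flip: powr_realpow)
    \<comment> \<open>Here \<open>4 * q - 7 = 4 * k - 3\<close>, and
      \<open>22 * k / (4 * k - 3)\<close> is largest at \<open>k = 2\<close>, where it is
      \<open>44 / 5\<close>. The gap to the available exponent 9 is \<open>1 / 5\<close>, and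
      \<open>\<rho> powr (1 / 5)\<close> pays for the multiplicity
      \<open>44 * k + 40\<close>.\<close>
    also have "\<dots> \<le> real \<rho> powr (22 * real k + 44 / 5)"
    proof (rule powr_mono)
      have "22 * real k / (4 * real k - 3) \<le> 44 / 5" using x0 k by (simp add: field_simps)
      then show "22 * real k * (1 + 1 / (4 * real k - 3)) \<le> 22 * real k + 44 / 5"
        by (simp add: distrib_left)
    qed (use \<rho>(1) in auto)
    finally have 1: "real p powr ?e \<le> real \<rho> powr (22 * real k + 44 / 5)" .
    have "44 * real k + 40 \<le> ?T * ?T" 
    proof -
      have "44 * real k + 40 \<le> 1 * ?T" using kT k by simp
      also have "\<dots> \<le> ?T * ?T" using T400 by (intro mult_right_mono) auto
      finally show ?thesis .
    qed
    then have "(44 * real k + 40) ^ 5 \<le> (?T * ?T) ^ 5" by (intro power_mono) auto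
    also have "\<dots> = ?T ^ 10" by (simp add: power_mult_distrib flip: power_add)
    finally have "(44 * real k + 40) ^ 5 \<le> real \<rho>" by (rule le_\<rho>) simp
    then have "((44 * real k + 40) ^ 5) powr (1 / 5) \<le> real \<rho> powr (1 / 5)"
      by (intro powr_mono2) auto
    moreover have "((44 * real k + 40) ^ 5) powr (1 / 5) = 44 * real k + 40"
      using powr_powr[of "44 * real k + 40" 5 "1 / 5"] by simp
    ultimately have 2: "44 * real k + 40 \<le> real \<rho> powr (1 / 5)" by simp
    have "real p powr ?e * (44 * real k + 40) \<le> real \<rho> powr (22 * real k + 44 / 5) * real \<rho> powr (1 / 5)"
      using 1 2 by (intro mult_mono) auto
    also have "\<dots> = real \<rho> powr (real (22 * k + 9))" by (simp add: add.commute flip: powr_add)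
    also have "\<dots> = real (\<rho> ^ (22 * k + 9))" using \<rho>(1) by (subst powr_realpow) auto
    also have "\<dots> \<le> real (card X * (44 * k + 40))" using F_pierce[OF X] by (rule of_nat_mono)
    also have "\<dots> = real (card X) * (44 * real k + 40)" by simp
    finally show ?thesis by (rule mult_right_le_imp_le) simp
  qed
  have "ereal (real p powr ?e) \<le> ereal_of_enat (HD TYPE('d) p q)" if "CARD('d) \<ge> 2"
  proof (rule HD_ge_of_planar_family[OF that F(1) _ _ F(3) bound])
    show "convex S" if "S \<in> F" for S
      using F(2) that by (auto simp: is_line_def affine_imp_convex)
    show "S \<noteq> {}" if "S \<in> F" for S
      using F(2) that by (auto simp: is_line_def)
  qed
  moreover have "\<not> (\<exists>X. finite X \<and> pierces X F \<and> real (card X) < real p powr ?e)"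
    using bound by (metis not_le)
  ultimately show ?thesis using F by blast
qed

end
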